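(* For $k$ observables on an $n$-partite system with local dimensions $\bm d=(d_1,\dots,d_n)$ and total dimension $D=d_1\cdots d_n$, $$\mu_{n,\bm d,k}\ \ge\ \left[\frac{b}{D}\sqrt{\frac{D-1}{D-b^2}}\right]^k,\qquad b=\sqrt{\frac{D^n}{(2D-1)^{n-2}(D^2-1)+1}}.$$ Moreover, for a bipartite $d\times d$ system ($n=2$, $d_1=d_2=d$), $\mu_{d,k}\ge \frac{1}{(d^2-1)^k}$.
   Context: For Hermitian $A_1,\dots,A_k$ on $\mathbb{C}^{d_1}\otimes\cdots\otimes\mathbb{C}^{d_n}$, $L(A_1,\dots,A_k)=\{(\operatorname{Tr}\rho A_1,\dots,\operatorname{Tr}\rho A_k):\rho \text{ a density matrix}\}$ and $L_{\mathrm{SEP}}$ is the same set with $\rho$ restricted to fully separable states (convex combinations of $\rho^{(1)}\otimes\cdots\otimes\rho^{(n)}$). $\operatorname{vol}$ is $k$-dimensional Euclidean volume. $\mu_{n,\bm d,k}=\inf_{A_1,\dots,A_k}\operatorname{vol}L_{\mathrm{SEP}}(A_1,\dots,A_k)/\operatorname{vol}L(A_1,\dots,A_k)$, the infimum over $k$-tuples of Hermitian operators whose traceless parts $A_j-\frac{\operatorname{Tr}A_j}{D}\mathbb{1}$ are linearly independent. For $n=2$ and $d_1=d_2=d$ this is written $\mu_{d,k}$. *)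

theory Defs
  imports "HOL-Analysis.Analysis"
begin

text \<open>Operators on a finite-dimensional Hilbert space with orthonormal basis
 indexed by a finite set I are represented by their matrix entries
 A a b (a, b in I); entries outside I are irrelevant.\<close>

type_synonym 'i op = "'i \<Rightarrow> 'i \<Rightarrow> complex"

definition hermitian_on :: "'i set \<Rightarrow> 'i op \<Rightarrow> bool" where
  "hermitian_on I A \<longleftrightarrow> (\<forall>a\<in>I. \<forall>b\<in>I. A a b = cnj (A b a))"

definition tr :: "'i set \<Rightarrow> 'i op \<Rightarrow> complex" where
  "tr I A = (\<Sum>a\<in>I. A a a)"

definition mprod :: "'i set \<Rightarrow> 'i op \<Rightarrow> 'i op \<Rightarrow> 'i op" where
  "mprod I A B = (\<lambda>a c. \<Sum>b\<in>I. A a b * B b c)"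

definition psd_on :: "'i set \<Rightarrow> 'i op \<Rightarrow> bool" where
  "psd_on I A \<longleftrightarrow> (\<forall>v :: 'i \<Rightarrow> complex.
      Im (\<Sum>a\<in>I. \<Sum>b\<in>I. cnj (v a) * A a b * v b) = 0 \<and>
      0 \<le> Re (\<Sum>a\<in>I. \<Sum>b\<in>I. cnj (v a) * A a b * v b))"

definition density_on :: "'i set \<Rightarrow> 'i op \<Rightarrow> bool" where
  "density_on I \<rho> \<longleftrightarrow> hermitian_on I \<rho> \<and> psd_on I \<rho> \<and> tr I \<rho> = 1"

text \<open>The n-partite system with local dimensions d 0, ..., d (n-1):
 basis of the tensor product indexed by tuples (a_0,...,a_{n-1}), a_i < d i.\<close>
definition idx :: "nat \<Rightarrow> (nat \<Rightarrow> nat) \<Rightarrow> (nat \<Rightarrow> nat) set" where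
  "idx n d = PiE {..<n} (\<lambda>i. {..<d i})"

definition totdim :: "nat \<Rightarrow> (nat \<Rightarrow> nat) \<Rightarrow> nat" where
  "totdim n d = (\<Prod>i<n. d i)"

definition product_state :: "nat \<Rightarrow> (nat \<Rightarrow> nat) \<Rightarrow> (nat \<Rightarrow> nat) op \<Rightarrow> bool" where
  "product_state n d \<rho> \<longleftrightarrow>
     (\<exists>\<sigma> :: nat \<Rightarrow> nat op. (\<forall>i<n. density_on {..<d i} (\<sigma> i)) \<and>
        (\<forall>a\<in>idx n d. \<forall>b\<in>idx n d. \<rho> a b = (\<Prod>i<n. \<sigma> i (a i) (b i))))"

definition separable :: "nat \<Rightarrow> (nat \<Rightarrow> nat) \<Rightarrow> (nat \<Rightarrow> nat) op \<Rightarrow> bool" where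
  "separable n d \<rho> \<longleftrightarrow>
     (\<exists>(m::nat) (w :: nat \<Rightarrow> real) (\<tau> :: nat \<Rightarrow> (nat \<Rightarrow> nat) op).
        (\<forall>l<m. 0 \<le> w l \<and> product_state n d (\<tau> l)) \<and> (\<Sum>l<m. w l) = 1 \<and>
        (\<forall>a\<in>idx n d. \<forall>b\<in>idx n d. \<rho> a b = (\<Sum>l<m. complex_of_real (w l) * \<tau> l a b)))"

definition expvals :: "'i set \<Rightarrow> ('k::finite \<Rightarrow> 'i op) \<Rightarrow> 'i op \<Rightarrow> real^'k" where
  "expvals I A \<rho> = (\<chi> j. Re (tr I (mprod I \<rho> (A j))))"

definition jnr :: "nat \<Rightarrow> (nat \<Rightarrow> nat) \<Rightarrow> ('k::finite \<Rightarrow> (nat \<Rightarrow> nat) op) \<Rightarrow> (real^'k) set" where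
  "jnr n d A = expvals (idx n d) A ` {\<rho>. density_on (idx n d) \<rho>}"

definition jnr_sep :: "nat \<Rightarrow> (nat \<Rightarrow> nat) \<Rightarrow> ('k::finite \<Rightarrow> (nat \<Rightarrow> nat) op) \<Rightarrow> (real^'k) set" where
  "jnr_sep n d A = expvals (idx n d) A ` {\<rho>. density_on (idx n d) \<rho> \<and> separable n d \<rho>}"

definition traceless :: "'i set \<Rightarrow> 'i op \<Rightarrow> 'i op" where
  "traceless I A = (\<lambda>a b. A a b - (if a = b then tr I A / of_nat (card I) else 0))"

definition lin_indep_ops :: "'i set \<Rightarrow> ('k::finite \<Rightarrow> 'i op) \<Rightarrow> bool" where
  "lin_indep_ops I B \<longleftrightarrow> (\<forall>c :: 'k \<Rightarrow> real.
      (\<forall>a\<in>I. \<forall>b\<in>I. (\<Sum>j\<in>UNIV. complex_of_real (c j) * B j a b) = 0) \<longrightarrow> (\<forall>j. c j = 0))"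

definition admissible :: "nat \<Rightarrow> (nat \<Rightarrow> nat) \<Rightarrow> ('k::finite \<Rightarrow> (nat \<Rightarrow> nat) op) \<Rightarrow> bool" where
  "admissible n d A \<longleftrightarrow> (\<forall>j. hermitian_on (idx n d) (A j)) \<and>
      lin_indep_ops (idx n d) (\<lambda>j. traceless (idx n d) (A j))"

text \<open>mu_{n,d,k}, with k = CARD('k); the infimum is taken in the extended reals
 (so it is +infinity if no admissible tuple exists).\<close>
definition mu :: "nat \<Rightarrow> (nat \<Rightarrow> nat) \<Rightarrow> 'k::finite itself \<Rightarrow> ereal" where
  "mu n d _ = (INF A \<in> {A :: 'k \<Rightarrow> (nat \<Rightarrow> nat) op. admissible n d A}.
      ereal (measure lebesgue (jnr_sep n d A) / measure lebesgue (jnr n d A)))"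

end

theory Submission
  imports Defs
begin

text \<open>
  Call a Hermitian operator $W$ block-positive if it is nonnegative on product vectors.
  Dually to the separable balls of Gurvits and Barnum, every block-positive $W$ satisfies
  $\|W\|_2^2 \le R\,(\mathrm{Tr}\,W)^2$ with $R = \prod_{i \ge 2} (2 - 1/d_i) \le 1/b^2$ (indices from 0).

  For two parties $R = 1$: if $P, Q$ are two diagonal blocks and $X$ is the corresponding off-diagonal
  block, then $|\langle u, X u\rangle|^2 \le \langle u, P u\rangle \langle u, Q u\rangle$, and there is a
  frame $(u_k)$ with $\sum_k u_k u_k^* = 1$ and $\|X\|_2 \le \sum_k |\langle u_k, X u_k\rangle|$, so
  $\|X\|_2^2 \le \mathrm{Tr}\,P\;\mathrm{Tr}\,Q$.
  For a further party, slicing $W$ along $\alpha e_i \pm \beta e_j$ and subtracting isolates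
  $\bar\alpha\beta X + \mathrm{h.c.}$; the bound for the slices gives
  $\|X\|_2^2 \le 2R\,\mathrm{Tr}\,P\;\mathrm{Tr}\,Q$, and summation over blocks costs a factor $2 - 1/d_i$.

  By Cauchy-Schwarz, $W$ has nonnegative expectation in $\tau + \varepsilon(\rho - \tau)$, where
  $\tau$ is the maximally mixed state and $\rho$ any state, as soon as
  $\varepsilon^2 (RD - 1)(D - 1) \le 1$. Separating hyperplanes in $\mathbb{R}^k$ show that the
  homothetic copy of $L$ with ratio $\varepsilon$ about the image of $\tau$ lies in the closure of
  $L_{\mathrm{SEP}}$. Linear independence of the traceless parts gives $L$ nonzero volume.
\<close>

subsection \<open>Two by two matrices\<close>

text \<open>Discriminant criterion for the nonnegative form A x^2 - N x y + B y^2: it is evaluated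
  in its minimising direction (N, 2A) or (2B, N), and at (1, 1) if both diagonal coefficients
  vanish.\<close>

lemma sq_le_of_quadratic_bound:
  fixes A B N :: real
  assumes q: "\<And>\<alpha> \<beta>. \<alpha> * \<beta> * N \<le> \<alpha>\<^sup>2 * A + \<beta>\<^sup>2 * B" and N: "0 \<le> N"
  shows "N\<^sup>2 \<le> 4 * A * B"
proof -
  have A: "0 \<le> A" using q[of 1 0] by simp
  have B: "0 \<le> B" using q[of 0 1] by simp
  consider "A > 0" | "B > 0" | "A = 0" "B = 0" using A B by linarith
  then show ?thesis
  proof cases
    case 1
    have "N * (2 * A) * N \<le> N\<^sup>2 * A + (2 * A)\<^sup>2 * B" by (rule q)
    then have "A * N\<^sup>2 \<le> A * (4 * A * B)" by (simp add: power2_eq_square algebra_simps)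
    then show ?thesis using 1 by simp
  next
    case 2
    have "(2 * B) * N * N \<le> (2 * B)\<^sup>2 * A + N\<^sup>2 * B" by (rule q)
    then have "B * N\<^sup>2 \<le> B * (4 * A * B)" by (simp add: power2_eq_square algebra_simps)
    then show ?thesis using 2 by simp
  next
    case 3
    then have "N \<le> 0" using q[of 1 1] by simp
    then show ?thesis using 3 N by simp
  qed
qed

text \<open>The Hermitian 2x2 matrix with diagonal \<open>p\<close>, \<open>q\<close> and
  off-diagonal entry \<open>z\<close> is positive semidefinite, so its determinant is nonnegative. A
  phase \<open>w\<close> makes \<open>w * z\<close> real and reduces this to the real
  discriminant.\<close>

lemma cmod_sq_le_of_form_nonneg:
  fixes p q :: real and z :: complex
  assumes f: "\<And>\<alpha> \<beta>. 0 \<le> (cmod \<alpha>)\<^sup>2 * p + (cmod \<beta>)\<^sup>2 * q + 2 * Re (cnj \<alpha> * \<beta> * z)"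
  shows "(cmod z)\<^sup>2 \<le> p * q"
proof -
  obtain w where w: "cmod w = 1" "w * z = of_real (cmod z)"
  proof (cases "z = 0")
    case True then show ?thesis using that[of 1] by simp
  next
    case False
    have "cmod (cnj z / of_real (cmod z)) = 1" using False by (simp add: norm_divide)
    moreover have "cnj z / of_real (cmod z) * z = of_real (cmod z)"
      using False by (simp add: field_simps complex_norm_square[symmetric] power2_eq_square)
    ultimately show ?thesis using that by blast
  qed
  have "(2 * cmod z)\<^sup>2 \<le> 4 * p * q"
  proof (rule sq_le_of_quadratic_bound)
    fix \<alpha> \<beta> :: real
    have "Re (cnj (of_real \<alpha>) * (- of_real \<beta> * w) * z) = - \<alpha> * \<beta> * cmod z"
    proof -
      have "cnj (of_real \<alpha>) * (- of_real \<beta> * w) * z = of_real (- \<alpha> * \<beta>) * (w * z)"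
        by (simp add: algebra_simps)
      also have "\<dots> = of_real (- \<alpha> * \<beta> * cmod z)" unfolding w by simp
      finally show ?thesis by (simp only: Re_complex_of_real)
    qed
    moreover have "cmod (- of_real \<beta> * w) = \<bar>\<beta>\<bar>" using w by (simp add: norm_mult)
    ultimately show "\<alpha> * \<beta> * (2 * cmod z) \<le> \<alpha>\<^sup>2 * p + \<beta>\<^sup>2 * q"
      using f[of "of_real \<alpha>" "- of_real \<beta> * w"] by simp
  qed simp
  then show ?thesis by (simp add: power_mult_distrib)
qed

text \<open>The Hopf map from unit vectors of C^2 onto the sphere of Bloch vectors. A preimage is
  normalised by taking \<open>p\<close> real and positive, which fails only at the pole
  \<open>h = -1\<close>.\<close>

lemma hopf_surjective:
  fixes h :: real and w :: complex
  assumes "h\<^sup>2 + 4 * (cmod w)\<^sup>2 = 1"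
  obtains p q :: complex where "(cmod p)\<^sup>2 + (cmod q)\<^sup>2 = 1" "(cmod p)\<^sup>2 - (cmod q)\<^sup>2 = h" "cnj p * q = w"
proof (cases "h = -1")
  case True
  then show ?thesis using that[of 0 1] assms by simp
next
  case False
  have "h\<^sup>2 \<le> 1" using assms by (smt (verit) zero_le_power2)
  then have h: "-1 < h" using False by (simp add: abs_square_le_1 abs_le_iff)
  define s where "s = sqrt ((1 + h) / 2)"
  have s: "s > 0" "s\<^sup>2 = (1 + h) / 2" using h by (auto simp: s_def)
  have "(cmod w)\<^sup>2 = ((1 + h) / 2) * ((1 - h) / 2)"
    using assms by (simp add: field_simps power2_eq_square)
  then have "(cmod (w / of_real s))\<^sup>2 = ((1 + h) / 2) * ((1 - h) / 2) / ((1 + h) / 2)"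
    unfolding norm_divide power_divide norm_of_real power2_abs s(2) by (rule arg_cong)
  also have "\<dots> = (1 - h) / 2" using h by (intro nonzero_mult_div_cancel_left) simp
  finally have "(cmod (w / of_real s))\<^sup>2 = (1 - h) / 2" .
  then show ?thesis using that[of "of_real s" "w / of_real s"] s by (simp add: field_simps)
qed

text \<open>Rotating to an eigenbasis of the Hermitian part of $y$, or of the anti-Hermitian part,
  according to the sign of the real part of the determinant; $r$ is the diagonal entry of the
  traceless part in the new basis.\<close>

lemma rotation2_Re_det_nonneg:
  fixes m \<delta> y z :: complex
  assumes "0 \<le> Re (m\<^sup>2 - \<delta>\<^sup>2 - y * z)"
  obtains p q r :: complex where "(cmod p)\<^sup>2 + (cmod q)\<^sup>2 = 1"
    "r = of_real ((cmod p)\<^sup>2 - (cmod q)\<^sup>2) * \<delta> + cnj p * q * y + cnj q * p * z"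
    "2 * ((cmod m)\<^sup>2 + (cmod \<delta>)\<^sup>2) + (cmod y)\<^sup>2 + (cmod z)\<^sup>2 \<le> (cmod (m + r) + cmod (m - r))\<^sup>2"
proof -
  \<comment> \<open>For the matrix with diagonal \<open>m + \<delta>\<close>,
    \<open>m - \<delta>\<close> and off-diagonal entries \<open>y\<close>, \<open>z\<close>, the
    anti-Hermitian part of the traceless part is i times a Hermitian matrix with eigenvalues
    \<open>L\<close> and \<open>- L\<close>.\<close>
  define \<eta> where "\<eta> = y - cnj z"
  define L where "L = sqrt ((Im \<delta>)\<^sup>2 + (cmod \<eta>)\<^sup>2 / 4)"
  have L2: "L\<^sup>2 = (Im \<delta>)\<^sup>2 + (cmod \<eta>)\<^sup>2 / 4" by (simp add: L_def)
  obtain p q where pq: "(cmod p)\<^sup>2 + (cmod q)\<^sup>2 = 1"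
    and ImL: "((cmod p)\<^sup>2 - (cmod q)\<^sup>2) * Im \<delta> + Im (cnj p * q * \<eta>) = L"
  proof (cases "L = 0")
    case True
    then have "(Im \<delta>)\<^sup>2 + (cmod \<eta>)\<^sup>2 / 4 = 0" using L2 by simp
    then have "(Im \<delta>)\<^sup>2 = 0" by (smt (verit) zero_le_power2 divide_nonneg_pos)
    then show ?thesis using that[of 1 0] True by simp
  next
    case False
    \<comment> \<open>\<open>Im \<delta> / L\<close> and \<open>w\<close> encode the Bloch vector of
      the eigenvector for \<open>L\<close>; the phase of \<open>w\<close> makes
      \<open>w * \<eta>\<close> purely imaginary with nonnegative imaginary part.\<close>
    define w where "w = \<i> * cnj \<eta> / of_real (4 * L)"
    have "(cmod w)\<^sup>2 = (cmod \<eta>)\<^sup>2 / (16 * L\<^sup>2)"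
      by (simp add: w_def norm_mult norm_divide power_divide power_mult_distrib)
    then have "(Im \<delta> / L)\<^sup>2 + 4 * (cmod w)\<^sup>2 = ((Im \<delta>)\<^sup>2 + (cmod \<eta>)\<^sup>2 / 4) / L\<^sup>2"
      by (simp add: power_divide add_divide_distrib)
    then have "(Im \<delta> / L)\<^sup>2 + 4 * (cmod w)\<^sup>2 = L\<^sup>2 / L\<^sup>2"
      unfolding L2[symmetric] .
    then have "(Im \<delta> / L)\<^sup>2 + 4 * (cmod w)\<^sup>2 = 1" using False by simp
    then obtain p q where *: "(cmod p)\<^sup>2 + (cmod q)\<^sup>2 = 1" "(cmod p)\<^sup>2 - (cmod q)\<^sup>2 = Im \<delta> / L" "cnj p * q = w"
      by (rule hopf_surjective)
    have "w * \<eta> = \<i> * of_real ((cmod \<eta>)\<^sup>2) / of_real (4 * L)"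
      unfolding w_def complex_norm_square by (simp add: algebra_simps)
    also have "\<dots> = \<i> * of_real ((cmod \<eta>)\<^sup>2 / (4 * L))" by simp
    finally have "Im (w * \<eta>) = (cmod \<eta>)\<^sup>2 / (4 * L)" by (metis Im_i_times Re_complex_of_real)
    then have "Im \<delta> / L * Im \<delta> + Im (w * \<eta>) = L\<^sup>2 / L"
      unfolding L2 by (simp add: power2_eq_square add_divide_distrib)
    then show ?thesis using that[of p q] * False by (simp add: power2_eq_square)
  qed
  define r where "r = of_real ((cmod p)\<^sup>2 - (cmod q)\<^sup>2) * \<delta> + cnj p * q * y + cnj q * p * z"
  have "Im r = L"
    unfolding ImL[symmetric] r_def \<eta>_def by (simp add: algebra_simps)
  then have Imr: "2 * (Im r)\<^sup>2 = (cmod \<delta>)\<^sup>2 - Re (\<delta>\<^sup>2) + ((cmod y)\<^sup>2 + (cmod z)\<^sup>2) / 2 - Re (y * z)"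
    unfolding L2 \<open>Im r = L\<close> \<eta>_def cmod_power2 by (simp add: power2_eq_square field_simps)
  \<comment> \<open>The squared sum of the moduli of the new diagonal entries is 2|m|^2 + 2|r|^2 +
    2|m^2 - r^2|. Bounding the last modulus below by its real part and inserting \<open>Imr\<close>
    leaves the squared Frobenius norm plus twice the real part of the determinant.\<close>
  have "Re (m\<^sup>2 - r\<^sup>2) \<le> cmod (m + r) * cmod (m - r)"
    by (metis complex_Re_le_cmod norm_mult power2_eq_square square_diff_square_factored)
  moreover have "Re (r\<^sup>2) = (cmod r)\<^sup>2 - 2 * (Im r)\<^sup>2"
    unfolding cmod_power2 by (simp add: power2_eq_square)
  moreover have "(cmod (m + r) + cmod (m - r))\<^sup>2 = 2 * (cmod m)\<^sup>2 + 2 * (cmod r)\<^sup>2 + 2 * (cmod (m + r) * cmod (m - r))"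
    unfolding power2_sum cmod_power2 by (simp add: power2_eq_square algebra_simps)
  ultimately have "2 * ((cmod m)\<^sup>2 + (cmod \<delta>)\<^sup>2) + (cmod y)\<^sup>2 + (cmod z)\<^sup>2 \<le> (cmod (m + r) + cmod (m - r))\<^sup>2"
    using Imr assms unfolding minus_complex.simps by argo
  then show ?thesis using that pq r_def by blast
qed

text \<open>Multiplication by i negates the determinant and preserves all moduli, so the determinant
  may be assumed to have nonnegative real part. The two moduli on the right belong to the diagonal
  entries in the orthonormal basis \<open>(p, q)\<close>, \<open>(- cnj q, cnj p)\<close>.\<close>

lemma rotation2:
  fixes y11 y12 y21 y22 :: complex
  obtains p q :: complex where "(cmod p)\<^sup>2 + (cmod q)\<^sup>2 = 1"
    "(cmod y11)\<^sup>2 + (cmod y12)\<^sup>2 + (cmod y21)\<^sup>2 + (cmod y22)\<^sup>2 \<le>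
     (cmod (cnj p * p * y11 + cnj p * q * y12 + cnj q * p * y21 + cnj q * q * y22)
      + cmod (q * cnj q * y11 - q * cnj p * y12 - p * cnj q * y21 + p * cnj p * y22))\<^sup>2"
proof -
  define m where "m = (y11 + y22) / 2"
  define \<delta> where "\<delta> = (y11 - y22) / 2"
  have y: "y11 = m + \<delta>" "y22 = m - \<delta>" by (auto simp: m_def \<delta>_def field_simps)
  have "\<exists>p q r. (cmod p)\<^sup>2 + (cmod q)\<^sup>2 = 1 \<and>
    r = of_real ((cmod p)\<^sup>2 - (cmod q)\<^sup>2) * \<delta> + cnj p * q * y12 + cnj q * p * y21 \<and>
    2 * ((cmod m)\<^sup>2 + (cmod \<delta>)\<^sup>2) + (cmod y12)\<^sup>2 + (cmod y21)\<^sup>2 \<le> (cmod (m + r) + cmod (m - r))\<^sup>2"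
  proof (cases "0 \<le> Re (m\<^sup>2 - \<delta>\<^sup>2 - y12 * y21)")
    case True
    then show ?thesis by (rule rotation2_Re_det_nonneg) blast
  next
    case False
    then have "0 \<le> Re ((\<i> * m)\<^sup>2 - (\<i> * \<delta>)\<^sup>2 - (\<i> * y12) * (\<i> * y21))"
      by (simp add: power2_eq_square)
    then obtain p q r where 1: "(cmod p)\<^sup>2 + (cmod q)\<^sup>2 = 1"
      and r: "r = of_real ((cmod p)\<^sup>2 - (cmod q)\<^sup>2) * (\<i> * \<delta>) + cnj p * q * (\<i> * y12) + cnj q * p * (\<i> * y21)"
      and 2: "2 * ((cmod (\<i> * m))\<^sup>2 + (cmod (\<i> * \<delta>))\<^sup>2) + (cmod (\<i> * y12))\<^sup>2 + (cmod (\<i> * y21))\<^sup>2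
        \<le> (cmod (\<i> * m + r) + cmod (\<i> * m - r))\<^sup>2"
      by (rule rotation2_Re_det_nonneg)
    define s where "s = of_real ((cmod p)\<^sup>2 - (cmod q)\<^sup>2) * \<delta> + cnj p * q * y12 + cnj q * p * y21"
    have rs: "r = \<i> * s" unfolding r s_def by (simp add: algebra_simps)
    have "cmod (\<i> * m + r) = cmod (m + s)" "cmod (\<i> * m - r) = cmod (m - s)"
      unfolding rs by (simp_all add: norm_mult flip: distrib_left right_diff_distrib)
    then show ?thesis using 1 2 s_def by (auto simp: norm_mult)
  qed
  then obtain p q r where pq: "(cmod p)\<^sup>2 + (cmod q)\<^sup>2 = 1"
    and r: "r = of_real ((cmod p)\<^sup>2 - (cmod q)\<^sup>2) * \<delta> + cnj p * q * y12 + cnj q * p * y21"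
    and le: "2 * ((cmod m)\<^sup>2 + (cmod \<delta>)\<^sup>2) + (cmod y12)\<^sup>2 + (cmod y21)\<^sup>2 \<le> (cmod (m + r) + cmod (m - r))\<^sup>2"
    by blast
  have one: "p * cnj p + q * cnj q = 1"
    using pq by (metis complex_norm_square of_real_add of_real_1)
  have dif: "of_real ((cmod p)\<^sup>2 - (cmod q)\<^sup>2) = p * cnj p - q * cnj q"
    by (simp add: complex_norm_square flip: of_real_power)
  have "cnj p * p * y11 + cnj p * q * y12 + cnj q * p * y21 + cnj q * q * y22 = (p * cnj p + q * cnj q) * m + r"
    unfolding r dif y by (simp add: algebra_simps)
  moreover have "q * cnj q * y11 - q * cnj p * y12 - p * cnj q * y21 + p * cnj p * y22 = (p * cnj p + q * cnj q) * m - r"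
    unfolding r dif y by (simp add: algebra_simps)
  moreover have "(cmod y11)\<^sup>2 + (cmod y22)\<^sup>2 = 2 * ((cmod m)\<^sup>2 + (cmod \<delta>)\<^sup>2)"
    unfolding y cmod_power2 by (simp add: power2_eq_square algebra_simps)
  ultimately show ?thesis using that[of p q] pq le unfolding one by simp
qed

subsection \<open>Tight frames and the Frobenius norm\<close>

definition frob2 :: "'i set \<Rightarrow> 'i op \<Rightarrow> real" where
  "frob2 I A = (\<Sum>a\<in>I. \<Sum>b\<in>I. (cmod (A a b))\<^sup>2)"

definition sesq :: "'i set \<Rightarrow> 'i op \<Rightarrow> ('i \<Rightarrow> complex) \<Rightarrow> ('i \<Rightarrow> complex) \<Rightarrow> complex" where
  "sesq I A v w = (\<Sum>a\<in>I. \<Sum>b\<in>I. cnj (v a) * A a b * w b)"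

text \<open>A resolution of the identity. There are as many vectors as dimensions, so for finite
  \<open>I\<close> these are exactly the orthonormal bases; completeness is the form that yields the
  trace and Parseval identities directly.\<close>

definition tight_frame :: "'i set \<Rightarrow> ('i \<Rightarrow> 'i \<Rightarrow> complex) \<Rightarrow> bool" where
  "tight_frame I u \<longleftrightarrow>
     (\<forall>a\<in>I. \<forall>b\<in>I. (\<Sum>k\<in>I. u k a * cnj (u k b)) = (if a = b then 1 else 0))"

lemma tight_frame_sum_sesq:
  assumes "finite I" "tight_frame I u"
  shows "(\<Sum>k\<in>I. sesq I A (u k) (u k)) = tr I A"
proof -
  have "(\<Sum>k\<in>I. sesq I A (u k) (u k)) = (\<Sum>a\<in>I. \<Sum>b\<in>I. \<Sum>k\<in>I. cnj (u k a) * A a b * u k b)"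
    unfolding sesq_def by (subst sum.swap, rule sum.cong[OF refl], rule sum.swap)
  also have "\<dots> = (\<Sum>a\<in>I. \<Sum>b\<in>I. A a b * (\<Sum>k\<in>I. u k b * cnj (u k a)))"
    by (simp add: sum_distrib_left mult_ac)
  also have "\<dots> = (\<Sum>a\<in>I. \<Sum>b\<in>I. if b = a then A a b else 0)"
    using assms(2) unfolding tight_frame_def by (intro sum.cong refl) auto
  also have "\<dots> = tr I A" unfolding tr_def using assms(1) by simp
  finally show ?thesis .
qed

text \<open>The trace identity for the rank-one operator with entries
  \<open>f a * cnj (f b)\<close>.\<close>

lemma tight_frame_parseval:
  assumes "finite I" "tight_frame I u"
  shows "(\<Sum>k\<in>I. (cmod (\<Sum>a\<in>I. cnj (u k a) * f a))\<^sup>2) = (\<Sum>a\<in>I. (cmod (f a))\<^sup>2)"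
proof -
  have "complex_of_real (\<Sum>k\<in>I. (cmod (\<Sum>a\<in>I. cnj (u k a) * f a))\<^sup>2)
      = (\<Sum>k\<in>I. sesq I (\<lambda>a b. f a * cnj (f b)) (u k) (u k))"
    unfolding sesq_def of_real_sum complex_norm_square cnj_sum sum_product
    by (simp add: mult_ac)
  also have "\<dots> = complex_of_real (\<Sum>a\<in>I. (cmod (f a))\<^sup>2)"
    unfolding tight_frame_sum_sesq[OF assms] tr_def of_real_sum complex_norm_square ..
  finally show ?thesis using of_real_eq_iff by blast
qed

text \<open>Unitary invariance of the Frobenius norm, by Parseval in each argument of the
  form.\<close>

lemma tight_frame_sum_sesq_sq:
  assumes "finite I" "tight_frame I u"
  shows "(\<Sum>k\<in>I. \<Sum>l\<in>I. (cmod (sesq I A (u k) (u l)))\<^sup>2) = frob2 I A"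
proof -
  have "(\<Sum>k\<in>I. \<Sum>l\<in>I. (cmod (sesq I A (u k) (u l)))\<^sup>2)
      = (\<Sum>l\<in>I. \<Sum>k\<in>I. (cmod (\<Sum>a\<in>I. cnj (u k a) * (\<Sum>b\<in>I. A a b * u l b)))\<^sup>2)"
    unfolding sesq_def by (subst sum.swap) (simp add: sum_distrib_left mult_ac)
  also have "\<dots> = (\<Sum>a\<in>I. \<Sum>l\<in>I. (cmod (\<Sum>b\<in>I. A a b * u l b))\<^sup>2)"
    unfolding tight_frame_parseval[OF assms] by (rule sum.swap)
  also have "\<dots> = (\<Sum>a\<in>I. \<Sum>l\<in>I. (cmod (\<Sum>b\<in>I. cnj (u l b) * cnj (A a b)))\<^sup>2)"
  proof (intro sum.cong refl)
    fix a l
    have "(\<Sum>b\<in>I. cnj (u l b) * cnj (A a b)) = cnj (\<Sum>b\<in>I. A a b * u l b)"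
      by (simp add: mult.commute)
    then show "(cmod (\<Sum>b\<in>I. A a b * u l b))\<^sup>2 = (cmod (\<Sum>b\<in>I. cnj (u l b) * cnj (A a b)))\<^sup>2"
      by (simp only: complex_mod_cnj)
  qed
  also have "\<dots> = frob2 I A"
    unfolding tight_frame_parseval[OF assms] frob2_def by simp
  finally show ?thesis .
qed

lemma sesq_comb:
  "sesq I A (\<lambda>a. \<alpha> * v a + \<beta> * w a) (\<lambda>a. \<gamma> * v a + \<delta> * w a) =
    cnj \<alpha> * \<gamma> * sesq I A v v + cnj \<alpha> * \<delta> * sesq I A v w
    + cnj \<beta> * \<gamma> * sesq I A w v + cnj \<beta> * \<delta> * sesq I A w w"
  unfolding sesq_def by (simp add: algebra_simps sum.distrib sum_distrib_left)

lemma sum_remove2: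
  fixes f :: "'i \<Rightarrow> 'b::comm_monoid_add"
  assumes "finite I" "k \<in> I" "l \<in> I" "k \<noteq> l"
  shows "sum f I = f k + f l + sum f (I - {k, l})"
proof -
  have "sum f I = f k + sum f (I - {k})" using assms by (simp add: sum.remove)
  also have "sum f (I - {k}) = f l + sum f (I - {k} - {l})" using assms by (simp add: sum.remove)
  finally show ?thesis by (simp add: add.assoc Diff_insert2[of I k "{l}"])
qed

text \<open>The change from the old pair of vectors to the new one is unitary, so the sum of the two
  rank-one operators stays the same.\<close>

lemma tight_frame_rotate:
  assumes I: "finite I" "k \<in> I" "l \<in> I" "k \<noteq> l" and u: "tight_frame I u"
    and pq: "(cmod p)\<^sup>2 + (cmod q)\<^sup>2 = 1"
  shows "tight_frame I (u(k := \<lambda>a. p * u k a + q * u l a, l := \<lambda>a. - cnj q * u k a + cnj p * u l a))"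
    (is "tight_frame I ?u")
  unfolding tight_frame_def
proof (intro ballI)
  fix a b assume ab: "a \<in> I" "b \<in> I"
  have one: "p * cnj p + q * cnj q = 1"
    using pq by (metis complex_norm_square of_real_add of_real_1)
  have "?u k a * cnj (?u k b) + ?u l a * cnj (?u l b)
      = (p * cnj p + q * cnj q) * (u k a * cnj (u k b) + u l a * cnj (u l b))"
    using I(4) by (simp add: algebra_simps)
  moreover have "(\<Sum>j\<in>I - {k, l}. ?u j a * cnj (?u j b)) = (\<Sum>j\<in>I - {k, l}. u j a * cnj (u j b))"
    by (intro sum.cong) auto
  ultimately have "(\<Sum>j\<in>I. ?u j a * cnj (?u j b)) = (\<Sum>j\<in>I. u j a * cnj (u j b))"
    unfolding sum_remove2[OF I] one by simp
  then show "(\<Sum>j\<in>I. ?u j a * cnj (?u j b)) = (if a = b then 1 else 0)"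
    using u ab unfolding tight_frame_def by simp
qed

text \<open>By completeness every entry has modulus at most one. After extension by zero outside
  \<open>I\<close> the frames therefore form a closed subset of a product of discs, which is compact
  by Tychonoff.\<close>

lemma compact_tight_frames:
  assumes "finite I"
  shows "compact {u :: 'i \<Rightarrow> 'i \<Rightarrow> complex. tight_frame I u \<and> (\<forall>k a. k \<notin> I \<or> a \<notin> I \<longrightarrow> u k a = 0)}"
    (is "compact ?S")
proof -
  have comp: "compact (PiE UNIV S)" if "\<And>i. compact (S i)" for S :: "'c \<Rightarrow> 'd::topological_space set"
    using compactin_PiE[of "\<lambda>_. euclidean" UNIV S] that
    by (simp add: euclidean_product_topology)
  define B where "B = (PiE UNIV (\<lambda>_. PiE UNIV (\<lambda>_. cball 0 1)) :: ('i \<Rightarrow> 'i \<Rightarrow> complex) set)"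
  have "compact B" unfolding B_def by (intro comp compact_cball)
  have cont: "continuous_on UNIV (\<lambda>u :: 'i \<Rightarrow> 'i \<Rightarrow> complex. u k a)" for k a
    by (rule continuous_on_product_then_coordinatewise[OF continuous_on_product_coordinates])
  have "closed ?S"
    unfolding tight_frame_def Ball_def
    by (intro closed_Collect_conj closed_Collect_all closed_Collect_imp closed_Collect_eq
        open_Collect_const continuous_intros cont)
  have "?S \<subseteq> B"
  proof
    fix u assume u: "u \<in> ?S"
    have "cmod (u k a) \<le> 1" for k a
    proof (cases "k \<in> I \<and> a \<in> I")
      case True
      have "complex_of_real (\<Sum>j\<in>I. (cmod (u j a))\<^sup>2) = 1"
        using u True by (simp add: tight_frame_def complex_norm_square del: of_real_power)
      then have "(\<Sum>j\<in>I. (cmod (u j a))\<^sup>2) = 1" using of_real_eq_1_iff by blast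
      moreover have "(cmod (u k a))\<^sup>2 \<le> (\<Sum>j\<in>I. (cmod (u j a))\<^sup>2)"
        using True assms by (intro member_le_sum) auto
      ultimately show ?thesis by (simp add: abs_square_le_1)
    qed (use u in auto)
    then show "u \<in> B" by (auto simp: B_def PiE_iff)
  qed
  then show ?thesis
    using compact_Int_closed[OF \<open>compact B\<close> \<open>closed ?S\<close>] by (simp add: Int_absorb1)
qed

text \<open>A frame maximising the sum satisfies
  $|Y_{kl}|^2 + |Y_{lk}|^2 \le 2\,|Y_{kk}|\,|Y_{ll}|$ for the matrix entries $Y$ of $A$, since
  otherwise rotating the $k$-th and $l$-th vectors would increase the sum.\<close>

lemma tight_frame_frob2_le:
  fixes I :: "'i set"
  assumes I: "finite I"
  obtains u where "tight_frame I u" "frob2 I A \<le> (\<Sum>k\<in>I. cmod (sesq I A (u k) (u k)))\<^sup>2"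
proof -
  define S where "S = {u :: 'i \<Rightarrow> 'i \<Rightarrow> complex. tight_frame I u \<and> (\<forall>k a. k \<notin> I \<or> a \<notin> I \<longrightarrow> u k a = 0)}"
  define G where "G u = (\<Sum>k\<in>I. cmod (sesq I A (u k) (u k)))" for u
  have cont: "continuous_on UNIV (\<lambda>u :: 'i \<Rightarrow> 'i \<Rightarrow> complex. u k a)" for k a
    by (rule continuous_on_product_then_coordinatewise[OF continuous_on_product_coordinates])
  have "continuous_on UNIV G"
    unfolding G_def sesq_def by (intro continuous_intros cont)
  then have "continuous_on S G" using continuous_on_subset by blast
  moreover have "compact S" unfolding S_def by (rule compact_tight_frames[OF I])
  \<comment> \<open>The standard basis is a frame, so the maximum is taken over a nonempty
    set.\<close>
  moreover have "(\<lambda>k a. if k = a \<and> a \<in> I then 1 else 0) \<in> S"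
  proof -
    have "(\<Sum>k\<in>I. (if k = a \<and> a \<in> I then 1 else 0) * cnj (if k = b \<and> b \<in> I then 1 else 0))
        = (if a = b then 1 else 0 :: complex)" if "a \<in> I" "b \<in> I" for a b
    proof -
      have "(\<Sum>k\<in>I. (if k = a \<and> a \<in> I then 1 else 0) * cnj (if k = b \<and> b \<in> I then 1 else 0))
        = (\<Sum>k\<in>I. if k = a then (if a = b then 1 else 0 :: complex) else 0)"
        using that by (intro sum.cong) auto
      then show ?thesis using that I by simp
    qed
    then show ?thesis unfolding S_def tight_frame_def by auto
  qed
  ultimately obtain u where u: "u \<in> S" and max: "\<And>v. v \<in> S \<Longrightarrow> G v \<le> G u"
    using continuous_attains_sup[of S G] by blast
  have frame: "tight_frame I u" using u by (simp add: S_def)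
  define Y where "Y k l = sesq I A (u k) (u l)" for k l
  have off: "(cmod (Y k l))\<^sup>2 + (cmod (Y l k))\<^sup>2 \<le> 2 * (cmod (Y k k) * cmod (Y l l))"
    if kl: "k \<in> I" "l \<in> I" for k l
  proof (cases "k = l")
    case False
    obtain p q where pq: "(cmod p)\<^sup>2 + (cmod q)\<^sup>2 = 1"
      and le: "(cmod (Y k k))\<^sup>2 + (cmod (Y k l))\<^sup>2 + (cmod (Y l k))\<^sup>2 + (cmod (Y l l))\<^sup>2 \<le>
     (cmod (cnj p * p * Y k k + cnj p * q * Y k l + cnj q * p * Y l k + cnj q * q * Y l l)
      + cmod (q * cnj q * Y k k - q * cnj p * Y k l - p * cnj q * Y l k + p * cnj p * Y l l))\<^sup>2"
      by (rule rotation2)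
    define v where "v = u(k := \<lambda>a. p * u k a + q * u l a, l := \<lambda>a. - cnj q * u k a + cnj p * u l a)"
    have "tight_frame I v" unfolding v_def by (rule tight_frame_rotate[OF I kl False frame pq])
    moreover have "v j a = 0" if "j \<notin> I \<or> a \<notin> I" for j a
      using that u kl unfolding v_def S_def by auto
    ultimately have "v \<in> S" unfolding S_def by blast
    then have "G v \<le> G u" by (rule max)
    moreover have "(\<Sum>j\<in>I - {k, l}. cmod (sesq I A (v j) (v j))) = (\<Sum>j\<in>I - {k, l}. cmod (sesq I A (u j) (u j)))"
      by (intro sum.cong) (auto simp: v_def)
    ultimately have "cmod (sesq I A (v k) (v k)) + cmod (sesq I A (v l) (v l)) \<le> cmod (Y k k) + cmod (Y l l)"
      unfolding G_def sum_remove2[OF I kl False] Y_def by simp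
    moreover have "sesq I A (v k) (v k) = cnj p * p * Y k k + cnj p * q * Y k l + cnj q * p * Y l k + cnj q * q * Y l l"
      using False unfolding v_def Y_def by (simp add: sesq_comb)
    moreover have "sesq I A (v l) (v l) = q * cnj q * Y k k - q * cnj p * Y k l - p * cnj q * Y l k + p * cnj p * Y l l"
      using False sesq_comb[of I A "- cnj q" "u k" "cnj p" "u l" "- cnj q" "cnj p"] unfolding v_def Y_def by simp
    ultimately have "(cmod (Y k k))\<^sup>2 + (cmod (Y k l))\<^sup>2 + (cmod (Y l k))\<^sup>2 + (cmod (Y l l))\<^sup>2 \<le>
        (cmod (Y k k) + cmod (Y l l))\<^sup>2"
      using le by (smt (verit) norm_ge_zero power_mono)
    then show ?thesis by (simp add: power2_sum)
  qed (simp add: power2_eq_square)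
  \<comment> \<open>\<open>off\<close> bounds the entries at (k, l) and (l, k) only jointly, hence
    the symmetrised double sum.\<close>
  have "2 * frob2 I A = (\<Sum>k\<in>I. \<Sum>l\<in>I. (cmod (Y k l))\<^sup>2) + (\<Sum>k\<in>I. \<Sum>l\<in>I. (cmod (Y l k))\<^sup>2)"
    using tight_frame_sum_sesq_sq[OF I frame, of A] sum.swap[of "\<lambda>k l. (cmod (Y l k))\<^sup>2" I I]
    unfolding Y_def by simp
  also have "\<dots> = (\<Sum>k\<in>I. \<Sum>l\<in>I. (cmod (Y k l))\<^sup>2 + (cmod (Y l k))\<^sup>2)"
    by (simp add: sum.distrib)
  also have "\<dots> \<le> (\<Sum>k\<in>I. \<Sum>l\<in>I. 2 * (cmod (Y k k) * cmod (Y l l)))"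
    by (intro sum_mono off)
  also have "\<dots> = 2 * (G u)\<^sup>2"
    unfolding G_def Y_def power2_eq_square sum_product by (simp add: sum_distrib_left)
  finally show ?thesis using that[OF frame] unfolding G_def by simp
qed

subsection \<open>Block-positive operators\<close>

lemma frob2_nonneg [simp]: "0 \<le> frob2 I A"
  unfolding frob2_def by (intro sum_nonneg) auto

lemma sqrt_frob2_eq_L2_set: "sqrt (frob2 I A) = L2_set (\<lambda>(a, b). cmod (A a b)) (I \<times> I)"
  unfolding frob2_def L2_set_def by (simp add: sum.cartesian_product case_prod_unfold)

lemma sqrt_frob2_diff_le:
  "sqrt (frob2 I (\<lambda>a b. A a b - B a b)) \<le> sqrt (frob2 I A) + sqrt (frob2 I B)"
proof -
  have "L2_set (\<lambda>(a, b). cmod (A a b - B a b)) (I \<times> I)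
      \<le> L2_set (\<lambda>x. (\<lambda>(a, b). cmod (A a b)) x + (\<lambda>(a, b). cmod (B a b)) x) (I \<times> I)"
    by (intro L2_set_mono) (auto simp: norm_triangle_ineq4)
  then show ?thesis unfolding sqrt_frob2_eq_L2_set using L2_set_triangle_ineq order_trans by blast
qed

lemma frob2_scale: "frob2 I (\<lambda>a b. c * A a b) = (cmod c)\<^sup>2 * frob2 I A"
  unfolding frob2_def by (simp add: norm_mult power_mult_distrib sum_distrib_left)

lemma frob2_parallelogram:
  "frob2 I (\<lambda>a b. A a b + B a b) + frob2 I (\<lambda>a b. A a b - B a b) = 2 * frob2 I A + 2 * frob2 I B"
proof -
  have "(cmod (x + y))\<^sup>2 + (cmod (x - y))\<^sup>2 = 2 * (cmod x)\<^sup>2 + 2 * (cmod y)\<^sup>2" for x y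
    unfolding cmod_power2 by (simp add: power2_eq_square algebra_simps)
  then show ?thesis unfolding frob2_def by (simp add: sum_distrib_left flip: sum.distrib)
qed

text \<open>For the operator with blocks \<open>W i j\<close> this is its compression to the vector
  \<open>x\<close> in the factor indexed by \<open>J\<close>: a partial expectation, with
  \<open>x\<close> not normalised.\<close>

definition slice :: "'j set \<Rightarrow> ('j \<Rightarrow> 'j \<Rightarrow> 'i op) \<Rightarrow> ('j \<Rightarrow> complex) \<Rightarrow> 'i op" where
  "slice J W x = (\<lambda>a b. \<Sum>i\<in>J. \<Sum>j\<in>J. cnj (x i) * x j * W i j a b)"

lemma sum_single:
  fixes f :: "'j \<Rightarrow> 'b::comm_monoid_add"
  assumes "finite J" "i \<in> J" "\<And>k. k \<in> J \<Longrightarrow> k \<noteq> i \<Longrightarrow> f k = 0"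
  shows "sum f J = f i"
  using assms by (simp add: sum.remove)

lemma sum_pair:
  fixes f :: "'j \<Rightarrow> 'b::comm_monoid_add"
  assumes "finite J" "i \<in> J" "j \<in> J" "i \<noteq> j" "\<And>k. k \<in> J \<Longrightarrow> k \<noteq> i \<Longrightarrow> k \<noteq> j \<Longrightarrow> f k = 0"
  shows "sum f J = f i + f j"
  using assms by (simp add: sum_remove2)

lemma slice_single:
  assumes "finite J" "i \<in> J"
  shows "slice J W (\<lambda>k. if k = i then 1 else 0) = W i i"
  unfolding slice_def using assms by (simp add: sum_single[where i = i])

lemma slice_pair:
  assumes "finite J" "i \<in> J" "j \<in> J" "i \<noteq> j"
  shows "slice J W (\<lambda>k. if k = i then \<alpha> else if k = j then \<beta> else 0) = (\<lambda>a b.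
    cnj \<alpha> * \<alpha> * W i i a b + cnj \<alpha> * \<beta> * W i j a b + cnj \<beta> * \<alpha> * W j i a b + cnj \<beta> * \<beta> * W j j a b)"
  unfolding slice_def using assms by (simp add: sum_pair[where i = i and j = j] add.assoc)

lemma sesq_slice:
  "sesq I (slice J W x) v w = (\<Sum>i\<in>J. \<Sum>j\<in>J. cnj (x i) * x j * sesq I (W i j) v w)"
proof -
  have "sesq I (slice J W x) v w
      = (\<Sum>a\<in>I. \<Sum>b\<in>I. \<Sum>i\<in>J. \<Sum>j\<in>J. cnj (x i) * x j * (cnj (v a) * W i j a b * w b))"
    unfolding sesq_def slice_def by (simp add: sum_distrib_left sum_distrib_right mult_ac)
  also have "\<dots> = (\<Sum>i\<in>J. \<Sum>j\<in>J. \<Sum>a\<in>I. \<Sum>b\<in>I. cnj (x i) * x j * (cnj (v a) * W i j a b * w b))"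
  proof -
    have swap3: "(\<Sum>b\<in>I. \<Sum>i\<in>J. \<Sum>j\<in>J. g b i j) = (\<Sum>i\<in>J. \<Sum>j\<in>J. \<Sum>b\<in>I. g b i j)"
      for g :: "'a \<Rightarrow> 'b \<Rightarrow> 'b \<Rightarrow> complex"
      by (subst sum.swap) (intro sum.cong refl sum.swap)
    show ?thesis by (subst swap3[symmetric]) (intro sum.cong refl swap3)
  qed
  finally show ?thesis unfolding sesq_def by (simp add: sum_distrib_left)
qed

text \<open>Polarisation isolates the off-diagonal blocks: the slices along \<alpha> e_i + \<beta>
  \<omega> e_j and \<alpha> e_i - \<beta> \<omega> e_j differ by a multiple of
  \<open>Z \<omega>\<close>, while in the sum of their traces only diagonal blocks survive. The
  triangle inequality gives a quadratic form in real \<alpha>, \<beta>, whose discriminant bounds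
  \<open>Z \<omega>\<close>.\<close>

lemma frob2_block_le_of_norm_bound:
  assumes J: "finite J" "i \<in> J" "j \<in> J" "i \<noteq> j"
    and herm: "\<And>a b. a \<in> I \<Longrightarrow> b \<in> I \<Longrightarrow> W j i a b = cnj (W i j b a)"
    and bound: "\<And>x. sqrt (frob2 I (slice J W x)) \<le> K * Re (tr I (slice J W x))"
  shows "frob2 I (W i j) \<le> 2 * K\<^sup>2 * (Re (tr I (W i i)) * Re (tr I (W j j)))"
proof -
  define Z where "Z \<omega> = (\<lambda>a b. \<omega> * W i j a b + cnj \<omega> * W j i a b)" for \<omega>
  have Z: "frob2 I (Z \<omega>) \<le> 4 * (K * Re (tr I (W i i))) * (K * Re (tr I (W j j)))"
    if \<omega>: "cmod \<omega> = 1" for \<omega>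
  proof -
    have "(sqrt (frob2 I (Z \<omega>)))\<^sup>2 \<le> 4 * (K * Re (tr I (W i i))) * (K * Re (tr I (W j j)))"
    proof (rule sq_le_of_quadratic_bound)
      fix \<alpha> \<beta> :: real
      have one: "cnj \<omega> * \<omega> = 1" using \<omega> by (metis complex_norm_square mult.commute of_real_1 one_power2)
      define S where "S \<epsilon> = slice J W (\<lambda>k. if k = i then of_real \<alpha> else if k = j then of_real (\<epsilon> * \<beta>) * \<omega> else 0)"
        for \<epsilon> :: real
      have S: "S \<epsilon> a b = of_real (\<alpha>\<^sup>2) * W i i a b + of_real (\<epsilon> * (\<alpha> * \<beta>)) * Z \<omega> a b
          + (cnj \<omega> * \<omega>) * of_real (\<epsilon>\<^sup>2 * \<beta>\<^sup>2) * W j j a b" for \<epsilon> a b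
        unfolding S_def slice_pair[OF J] Z_def by (simp add: algebra_simps power2_eq_square)
      have "(\<lambda>a b. S 1 a b - S (-1) a b) = (\<lambda>a b. of_real (2 * (\<alpha> * \<beta>)) * Z \<omega> a b)"
        unfolding S one by (simp add: algebra_simps)
      then have "sqrt (frob2 I (\<lambda>a b. S 1 a b - S (-1) a b)) = 2 * \<bar>\<alpha> * \<beta>\<bar> * sqrt (frob2 I (Z \<omega>))"
        by (simp only: frob2_scale real_sqrt_mult real_sqrt_abs abs_norm_cancel norm_of_real)
      then have "2 * \<bar>\<alpha> * \<beta>\<bar> * sqrt (frob2 I (Z \<omega>)) \<le> sqrt (frob2 I (S 1)) + sqrt (frob2 I (S (-1)))"
        using sqrt_frob2_diff_le[of I "S 1" "S (-1)"] by simp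
      also have "\<dots> \<le> K * Re (tr I (S 1)) + K * Re (tr I (S (-1)))"
        unfolding S_def by (intro add_mono bound)
      also have "\<dots> = K * Re (tr I (S 1) + tr I (S (-1)))" by (simp add: algebra_simps)
      also have "tr I (S 1) + tr I (S (-1)) = of_real (2 * \<alpha>\<^sup>2) * tr I (W i i) + of_real (2 * \<beta>\<^sup>2) * tr I (W j j)"
        unfolding tr_def S one sum.distrib[symmetric] sum_distrib_left
        by (intro sum.cong refl) (simp add: algebra_simps)
      finally have "\<bar>\<alpha> * \<beta>\<bar> * sqrt (frob2 I (Z \<omega>)) \<le> \<alpha>\<^sup>2 * (K * Re (tr I (W i i))) + \<beta>\<^sup>2 * (K * Re (tr I (W j j)))"
        by (simp add: algebra_simps)
      moreover have "\<alpha> * \<beta> * sqrt (frob2 I (Z \<omega>)) \<le> \<bar>\<alpha> * \<beta>\<bar> * sqrt (frob2 I (Z \<omega>))"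
        by (intro mult_right_mono) auto
      ultimately show "\<alpha> * \<beta> * sqrt (frob2 I (Z \<omega>)) \<le> \<alpha>\<^sup>2 * (K * Re (tr I (W i i))) + \<beta>\<^sup>2 * (K * Re (tr I (W j j)))"
        by linarith
    qed simp
    then show ?thesis by simp
  qed
  \<comment> \<open>The phases 1 and i give the sum and, up to a unit factor, the difference of the
    block and its adjoint; the parallelogram law recovers the block.\<close>
  have "frob2 I (Z \<i>) = frob2 I (\<lambda>a b. \<i> * (W i j a b - W j i a b))"
    unfolding Z_def by (simp add: algebra_simps)
  also have "\<dots> = frob2 I (\<lambda>a b. W i j a b - W j i a b)" by (simp add: frob2_scale)
  finally have "frob2 I (Z 1) + frob2 I (Z \<i>) = 2 * frob2 I (W i j) + 2 * frob2 I (W j i)"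
    using frob2_parallelogram[of I "W i j" "W j i"] unfolding Z_def by simp
  moreover have "frob2 I (W j i) = frob2 I (W i j)"
  proof -
    have "frob2 I (W j i) = (\<Sum>a\<in>I. \<Sum>b\<in>I. (cmod (W i j b a))\<^sup>2)"
      unfolding frob2_def using herm by (intro sum.cong refl) simp
    also have "\<dots> = frob2 I (W i j)" unfolding frob2_def by (rule sum.swap)
    finally show ?thesis .
  qed
  ultimately show ?thesis using Z[of 1] Z[of \<i>] by (simp add: power2_eq_square mult_ac)
qed

text \<open>Off-diagonal blocks cost a factor 2, diagonal blocks, being slices themselves, only 1.
  The saving is the sum of the squared traces, at least the squared total trace divided by
  \<open>card J\<close>.\<close>

lemma sum_frob2_block_le_of_norm_bound:
  assumes J: "finite J" "J \<noteq> {}" and K: "0 \<le> K"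
    and herm: "\<And>i j a b. i \<in> J \<Longrightarrow> j \<in> J \<Longrightarrow> a \<in> I \<Longrightarrow> b \<in> I \<Longrightarrow> W j i a b = cnj (W i j b a)"
    and bound: "\<And>x. sqrt (frob2 I (slice J W x)) \<le> K * Re (tr I (slice J W x))"
  shows "(\<Sum>i\<in>J. \<Sum>j\<in>J. frob2 I (W i j)) \<le> K\<^sup>2 * (2 - 1 / card J) * (\<Sum>i\<in>J. Re (tr I (W i i)))\<^sup>2"
proof -
  define t where "t i = Re (tr I (W i i))" for i
  have le: "frob2 I (W i j) \<le> K\<^sup>2 * (2 * (t i * t j) - (if i = j then (t i)\<^sup>2 else 0))"
    if ij: "i \<in> J" "j \<in> J" for i j
  proof (cases "i = j")
    case True
    have "sqrt (frob2 I (W i i)) \<le> K * t i"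
      using bound[of "\<lambda>k. if k = i then 1 else 0"] unfolding slice_single[OF J(1) ij(1)] t_def .
    then have "(sqrt (frob2 I (W i i)))\<^sup>2 \<le> (K * t i)\<^sup>2" by (intro power_mono) auto
    then show ?thesis using True by (simp add: power2_eq_square mult_ac)
  next
    case False
    then show ?thesis
      using frob2_block_le_of_norm_bound[OF J(1) ij False herm bound] ij unfolding t_def by simp
  qed
  have "(\<Sum>i\<in>J. \<Sum>j\<in>J. frob2 I (W i j))
      \<le> (\<Sum>i\<in>J. \<Sum>j\<in>J. K\<^sup>2 * (2 * (t i * t j) - (if i = j then (t i)\<^sup>2 else 0)))"
    by (intro sum_mono le)
  also have "\<dots> = K\<^sup>2 * (2 * (\<Sum>i\<in>J. t i)\<^sup>2 - (\<Sum>i\<in>J. (t i)\<^sup>2))"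
  proof -
    have "(\<Sum>i\<in>J. \<Sum>j\<in>J. if i = j then (t i)\<^sup>2 else 0) = (\<Sum>i\<in>J. (t i)\<^sup>2)" using J(1) by simp
    then show ?thesis
      unfolding power2_eq_square[of "sum t J"] sum_product
      by (simp add: sum_subtractf flip: sum_distrib_left)
  qed
  also have "\<dots> \<le> K\<^sup>2 * (2 * (\<Sum>i\<in>J. t i)\<^sup>2 - (\<Sum>i\<in>J. t i)\<^sup>2 / card J)"
  proof (intro mult_left_mono diff_left_mono)
    have "(\<Sum>i\<in>J. t i)\<^sup>2 \<le> (\<Sum>i\<in>J. (t i)\<^sup>2) * card J" by (rule sum_squared_le_sum_of_squares)
    then show "(\<Sum>i\<in>J. t i)\<^sup>2 / card J \<le> (\<Sum>i\<in>J. (t i)\<^sup>2)"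
      using J by (simp add: divide_le_eq card_gt_0_iff)
  qed simp
  finally show ?thesis unfolding t_def by (simp add: algebra_simps)
qed

text \<open>The two-party bound: \<open>nonneg\<close> is nonnegativity on all vectors x tensor v.
  Each off-diagonal block is controlled by its diagonal values in a well-chosen frame instead of by
  polarisation, which avoids the factor 2.\<close>

lemma sum_frob2_block_le_of_nonneg:
  assumes I: "finite I" and J: "finite J"
    and herm: "\<And>i j a b. i \<in> J \<Longrightarrow> j \<in> J \<Longrightarrow> a \<in> I \<Longrightarrow> b \<in> I \<Longrightarrow> W j i a b = cnj (W i j b a)"
    and nonneg: "\<And>x v. 0 \<le> Re (sesq I (slice J W x) v v)"
  shows "(\<Sum>i\<in>J. \<Sum>j\<in>J. frob2 I (W i j)) \<le> (\<Sum>i\<in>J. Re (tr I (W i i)))\<^sup>2"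
proof -
  define t where "t i = Re (tr I (W i i))" for i
  have "frob2 I (W i j) \<le> t i * t j" if ij: "i \<in> J" "j \<in> J" for i j
  proof -
    define p where "p i v = Re (sesq I (W i i) v v)" for i v
    have p0: "0 \<le> p i v" if "i \<in> J" for i v
      using nonneg[of "\<lambda>k. if k = i then 1 else 0"] unfolding slice_single[OF J that] p_def .
    have adj: "sesq I (W j i) v v = cnj (sesq I (W i j) v v)" if "i \<in> J" "j \<in> J" for i j v
    proof -
      have "sesq I (W j i) v v = (\<Sum>a\<in>I. \<Sum>b\<in>I. cnj (cnj (v b) * W i j b a * v a))"
        unfolding sesq_def using herm[OF that] by (intro sum.cong refl) simp
      also have "\<dots> = cnj (sesq I (W i j) v v)" unfolding sesq_def by (subst sum.swap) simp
      finally show ?thesis .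
    qed
    \<comment> \<open>The values at \<open>v\<close> of the forms of the blocks form a positive
      semidefinite 2x2 matrix, since slices along combinations of e_i and e_j are nonnegative at
      \<open>v\<close>.\<close>
    have pp: "(cmod (sesq I (W i j) v v))\<^sup>2 \<le> p i v * p j v" for v
    proof (cases "i = j")
      case True
      have "Im (sesq I (W i i) v v) = 0" using adj[OF ij(1) ij(1), of v] by (simp add: complex_eq_iff)
      then show ?thesis using True unfolding p_def cmod_power2 by (simp add: power2_eq_square)
    next
      case False
      show ?thesis
      proof (rule cmod_sq_le_of_form_nonneg)
        fix \<alpha> \<beta> :: complex
        have "sesq I (slice J W (\<lambda>k. if k = i then \<alpha> else if k = j then \<beta> else 0)) v v =
          of_real ((cmod \<alpha>)\<^sup>2) * sesq I (W i i) v v + of_real ((cmod \<beta>)\<^sup>2) * sesq I (W j j) v v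
          + (cnj \<alpha> * \<beta> * sesq I (W i j) v v + cnj (cnj \<alpha> * \<beta> * sesq I (W i j) v v))"
          unfolding sesq_slice using J ij False adj[OF ij, of v]
          by (simp add: sum_pair[where i = i and j = j] complex_norm_square algebra_simps del: of_real_power)
        then show "0 \<le> (cmod \<alpha>)\<^sup>2 * p i v + (cmod \<beta>)\<^sup>2 * p j v + 2 * Re (cnj \<alpha> * \<beta> * sesq I (W i j) v v)"
          using nonneg[of "\<lambda>k. if k = i then \<alpha> else if k = j then \<beta> else 0" v]
          unfolding p_def complex_add_cnj by (simp del: of_real_power)
      qed
    qed
    \<comment> \<open>The frame is adapted to \<open>W i j\<close>, but the traces of both diagonal
      blocks can be computed in the same frame, so Cauchy-Schwarz over its vectors suffices.\<close>
    obtain u where frame: "tight_frame I u"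
      and u: "frob2 I (W i j) \<le> (\<Sum>k\<in>I. cmod (sesq I (W i j) (u k) (u k)))\<^sup>2"
      by (rule tight_frame_frob2_le[OF I])
    note u
    also have "(\<Sum>k\<in>I. cmod (sesq I (W i j) (u k) (u k)))\<^sup>2 \<le> (\<Sum>k\<in>I. sqrt (p i (u k)) * sqrt (p j (u k)))\<^sup>2"
      using pp by (intro power_mono sum_mono sum_nonneg) (auto intro: real_le_rsqrt simp flip: real_sqrt_mult)
    also have "\<dots> \<le> (\<Sum>k\<in>I. (sqrt (p i (u k)))\<^sup>2) * (\<Sum>k\<in>I. (sqrt (p j (u k)))\<^sup>2)"
      by (rule Cauchy_Schwarz_ineq_sum)
    also have "\<dots> = t i * t j"
      using p0[OF ij(1)] p0[OF ij(2)] unfolding t_def tight_frame_sum_sesq[OF I frame, symmetric] p_def by simp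
    finally show ?thesis .
  qed
  then have "(\<Sum>i\<in>J. \<Sum>j\<in>J. frob2 I (W i j)) \<le> (\<Sum>i\<in>J. \<Sum>j\<in>J. t i * t j)"
    by (intro sum_mono)
  then show ?thesis unfolding t_def by (simp add: power2_eq_square sum_product)
qed

section \<open>Splitting off the last tensor factor\<close>

lemma finite_idx [simp]: "finite (idx n d)"
  unfolding idx_def by (intro finite_PiE) auto

lemma card_idx: "card (idx n d) = totdim n d"
  unfolding idx_def totdim_def by (simp add: card_PiE)

text \<open>Tuples in \<open>idx n d\<close> are extensional, with value \<open>undefined\<close> at
  \<open>n\<close>; resetting that coordinate inverts the appending of a last index.\<close>

lemma fun_upd_undefined_idx: "a \<in> idx n d \<Longrightarrow> a(n := i, n := undefined) = a"
  unfolding idx_def by (drule PiE_arb[where x = n]) auto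

lemma sum_idx_Suc:
  fixes f :: "(nat \<Rightarrow> nat) \<Rightarrow> 'b::comm_monoid_add"
  shows "(\<Sum>a\<in>idx (Suc n) d. f a) = (\<Sum>i<d n. \<Sum>a\<in>idx n d. f (a(n := i)))"
proof -
  have inj: "inj_on (\<lambda>(i, a). a(n := i)) ({..<d n} \<times> idx n d)"
    by (rule inj_on_inverseI[where g = "\<lambda>b. (b n, b(n := undefined))"])
      (use fun_upd_undefined_idx in force)
  have "idx (Suc n) d = (\<lambda>(i, a). a(n := i)) ` ({..<d n} \<times> idx n d)"
    unfolding idx_def lessThan_Suc PiE_insert_eq ..
  then have "sum f (idx (Suc n) d) = sum (f \<circ> (\<lambda>(i, a). a(n := i))) ({..<d n} \<times> idx n d)"
    by (simp only: sum.reindex[OF inj])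
  then show ?thesis by (simp add: sum.cartesian_product case_prod_unfold)
qed

lemma fun_upd_in_idx_Suc: "a \<in> idx n d \<Longrightarrow> i < d n \<Longrightarrow> a(n := i) \<in> idx (Suc n) d"
  unfolding idx_def lessThan_Suc by (rule PiE_fun_upd) auto

text \<open>The dual cone of the separable states. The form of a Hermitian operator is real, so its
  real part carries the whole condition.\<close>

definition block_positive :: "nat \<Rightarrow> (nat \<Rightarrow> nat) \<Rightarrow> (nat \<Rightarrow> nat) op \<Rightarrow> bool" where
  "block_positive n d W \<longleftrightarrow> hermitian_on (idx n d) W \<and>
    (\<forall>v :: nat \<Rightarrow> nat \<Rightarrow> complex. 0 \<le> Re (sesq (idx n d) W (\<lambda>a. \<Prod>i<n. v i (a i)) (\<lambda>a. \<Prod>i<n. v i (a i))))"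

definition blocks :: "nat \<Rightarrow> (nat \<Rightarrow> nat) op \<Rightarrow> nat \<Rightarrow> nat \<Rightarrow> (nat \<Rightarrow> nat) op" where
  "blocks n W i j = (\<lambda>a b. W (a(n := i)) (b(n := j)))"

lemma blocks_hermitian:
  assumes "hermitian_on (idx (Suc n) d) W" "i < d n" "j < d n" "a \<in> idx n d" "b \<in> idx n d"
  shows "blocks n W j i a b = cnj (blocks n W i j b a)"
  using assms(1)[unfolded hermitian_on_def, rule_format,
      OF fun_upd_in_idx_Suc[OF assms(4,3)] fun_upd_in_idx_Suc[OF assms(5,2)]]
  unfolding blocks_def .

lemma slice_hermitian:
  assumes "\<And>i j a b. i \<in> J \<Longrightarrow> j \<in> J \<Longrightarrow> a \<in> I \<Longrightarrow> b \<in> I \<Longrightarrow> W j i a b = cnj (W i j b a)"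
  shows "hermitian_on I (slice J W x)"
  unfolding hermitian_on_def
proof (intro ballI)
  fix a b assume ab: "a \<in> I" "b \<in> I"
  have "slice J W x a b = (\<Sum>i\<in>J. \<Sum>j\<in>J. cnj (cnj (x j) * x i * W j i b a))"
    unfolding slice_def using assms[OF _ _ ab] by (intro sum.cong refl) simp
  also have "\<dots> = cnj (slice J W x b a)"
    unfolding slice_def by (subst sum.swap) simp
  finally show "slice J W x a b = cnj (slice J W x b a)" .
qed

lemma tr_blocks: "tr (idx (Suc n) d) W = (\<Sum>i<d n. tr (idx n d) (blocks n W i i))"
  unfolding tr_def sum_idx_Suc blocks_def ..

lemma frob2_blocks:
  "frob2 (idx (Suc n) d) W = (\<Sum>i<d n. \<Sum>j<d n. frob2 (idx n d) (blocks n W i j))"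
  unfolding frob2_def sum_idx_Suc blocks_def by (intro sum.cong refl sum.swap)

text \<open>Compressing the last factor to \<open>x\<close> amounts to evaluating \<open>W\<close>
  at v tensor x and w tensor x; \<open>a(n := undefined)\<close> extracts the first \<open>n\<close>
  indices.\<close>

lemma sesq_blocks:
  "sesq (idx n d) (slice {..<d n} (blocks n W) x) v w
    = sesq (idx (Suc n) d) W (\<lambda>a. v (a(n := undefined)) * x (a n)) (\<lambda>a. w (a(n := undefined)) * x (a n))"
proof -
  have upd: "a(n := i, n := undefined) = a" if "a \<in> idx n d" for a i
    using that by (rule fun_upd_undefined_idx)
  have "sesq (idx (Suc n) d) W (\<lambda>a. v (a(n := undefined)) * x (a n)) (\<lambda>a. w (a(n := undefined)) * x (a n))
      = (\<Sum>i<d n. \<Sum>a\<in>idx n d. \<Sum>j<d n. \<Sum>b\<in>idx n d. cnj (x i) * x j * (cnj (v a) * blocks n W i j a b * w b))"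
    unfolding sesq_def sum_idx_Suc blocks_def using upd
    by (intro sum.cong refl) (simp add: mult_ac)
  also have "\<dots> = (\<Sum>i<d n. \<Sum>j<d n. \<Sum>a\<in>idx n d. \<Sum>b\<in>idx n d. cnj (x i) * x j * (cnj (v a) * blocks n W i j a b * w b))"
    by (intro sum.cong refl sum.swap)
  finally show ?thesis unfolding sesq_slice by (simp add: sesq_def sum_distrib_left)
qed

text \<open>A product vector tensored with \<open>x\<close> is again a product vector, with factors
  \<open>v(n := x)\<close>.\<close>

lemma block_positive_slice:
  assumes "block_positive (Suc n) d W"
  shows "block_positive n d (slice {..<d n} (blocks n W) x)"
  unfolding block_positive_def
proof (intro conjI allI)
  have h: "hermitian_on (idx (Suc n) d) W" using assms by (simp add: block_positive_def)
  show "hermitian_on (idx n d) (slice {..<d n} (blocks n W) x)"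
    by (rule slice_hermitian, rule blocks_hermitian[OF h]) simp_all
  fix v :: "nat \<Rightarrow> nat \<Rightarrow> complex"
  have "(\<Prod>i<n. v i ((a(n := undefined)) i)) = (\<Prod>i<n. (v(n := x)) i (a i))" for a
    by (intro prod.cong) auto
  then have eq: "(\<lambda>a. (\<Prod>i<n. v i ((a(n := undefined)) i)) * x (a n)) = (\<lambda>a. \<Prod>i<Suc n. (v(n := x)) i (a i))"
    by (simp only: prod.lessThan_Suc fun_upd_same)
  show "0 \<le> Re (sesq (idx n d) (slice {..<d n} (blocks n W) x) (\<lambda>a. \<Prod>i<n. v i (a i)) (\<lambda>a. \<Prod>i<n. v i (a i)))"
    unfolding sesq_blocks eq using assms unfolding block_positive_def by blast
qed

text \<open>With one party every vector is a product vector, once an index is identified with the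
  tuple that has it as its only entry.\<close>

lemma block_positive_1:
  assumes "block_positive (Suc 0) d W"
  shows "0 \<le> Re (sesq (idx (Suc 0) d) W y y)"
proof -
  define v :: "nat \<Rightarrow> nat \<Rightarrow> complex" where "v i m = y (\<lambda>k. if k = 0 then m else undefined)" for i m
  have "y a = (\<Prod>i<Suc 0. v i (a i))" if "a \<in> idx (Suc 0) d" for a
  proof -
    have "a = (\<lambda>k. if k = 0 then a 0 else undefined)"
      using that by (auto simp: idx_def PiE_iff extensional_def fun_eq_iff)
    then show ?thesis unfolding v_def by simp
  qed
  then have "sesq (idx (Suc 0) d) W y y =
      sesq (idx (Suc 0) d) W (\<lambda>a. \<Prod>i<Suc 0. v i (a i)) (\<lambda>a. \<Prod>i<Suc 0. v i (a i))"
    unfolding sesq_def by (intro sum.cong refl) simp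
  then show ?thesis using assms unfolding block_positive_def by simp
qed

text \<open>Slices of a two-party block-positive operator live on one party, where block-positivity
  is nonnegativity of the form on all vectors.\<close>

lemma block_positive_2:
  assumes "block_positive (Suc (Suc 0)) d W"
  shows "frob2 (idx (Suc (Suc 0)) d) W \<le> (Re (tr (idx (Suc (Suc 0)) d) W))\<^sup>2"
  unfolding frob2_blocks[of "Suc 0"] tr_blocks[of "Suc 0"] Re_sum
proof (rule sum_frob2_block_le_of_nonneg)
  have h: "hermitian_on (idx (Suc (Suc 0)) d) W" using assms by (simp add: block_positive_def)
  show "blocks (Suc 0) W j i a b = cnj (blocks (Suc 0) W i j b a)"
    if "i \<in> {..<d (Suc 0)}" "j \<in> {..<d (Suc 0)}" "a \<in> idx (Suc 0) d" "b \<in> idx (Suc 0) d" for i j a b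
    by (rule blocks_hermitian[OF h]) (use that in simp_all)
qed (use block_positive_1[OF block_positive_slice[OF assms]] in simp_all)

text \<open>Diagonal blocks are slices along basis vectors, hence again block-positive.\<close>

lemma Re_tr_nonneg_of_block_positive:
  assumes "block_positive n d W"
  shows "0 \<le> Re (tr (idx n d) W)"
  using assms
proof (induction n arbitrary: W)
  case 0
  then show ?case by (simp add: block_positive_def sesq_def tr_def idx_def)
next
  case (Suc n)
  have "0 \<le> Re (tr (idx n d) (blocks n W i i))" if "i < d n" for i
    using Suc.IH[OF block_positive_slice[OF Suc.prems, of "\<lambda>k. if k = i then 1 else 0"]] that
    by (simp add: slice_single)
  then show ?case unfolding tr_blocks Re_sum by (intro sum_nonneg) simp
qed

text \<open>Induction on the parties, starting from two: slices over the last party obey the bound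
  for the remaining ones, so the block estimate applies with \<open>K = sqrt R\<close> and
  contributes one more factor. The first two parties cost nothing, so the product starts at index
  2.\<close>

lemma frob2_le_of_block_positive:
  assumes "block_positive (m + 2) d W" "\<forall>i<m + 2. 0 < d i"
  shows "frob2 (idx (m + 2) d) W \<le> (\<Prod>i\<in>{2..<m + 2}. 2 - 1 / real (d i)) * (Re (tr (idx (m + 2) d) W))\<^sup>2"
  using assms
proof (induction m arbitrary: W)
  case 0
  then show ?case using block_positive_2 by (simp add: numeral_2_eq_2)
next
  case (Suc m)
  define R where "R = (\<Prod>i\<in>{2..<m + 2}. 2 - 1 / real (d i))"
  have dpos: "0 < d (m + 2)" using Suc.prems by simp
  have "0 \<le> 2 - 1 / real (d i)" if "i < m + 2" for i
  proof -
    have "0 < d i" using Suc.prems(2) that by simp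
    then have "1 / real (d i) \<le> 1" by simp
    then show ?thesis by linarith
  qed
  then have R: "0 \<le> R" unfolding R_def by (intro prod_nonneg) auto
  have W: "block_positive (Suc (m + 2)) d W" using Suc.prems by simp
  then have h: "hermitian_on (idx (Suc (m + 2)) d) W" by (simp add: block_positive_def)
  have "frob2 (idx (Suc (m + 2)) d) W \<le> (sqrt R)\<^sup>2 * (2 - 1 / card {..<d (m + 2)}) * (Re (tr (idx (Suc (m + 2)) d) W))\<^sup>2"
    unfolding frob2_blocks tr_blocks Re_sum
  proof (rule sum_frob2_block_le_of_norm_bound)
    show "blocks (m + 2) W j i a b = cnj (blocks (m + 2) W i j b a)"
      if "i \<in> {..<d (m + 2)}" "j \<in> {..<d (m + 2)}" "a \<in> idx (m + 2) d" "b \<in> idx (m + 2) d" for i j a b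
      by (rule blocks_hermitian[OF h]) (use that in simp_all)
    fix x
    let ?V = "slice {..<d (m + 2)} (blocks (m + 2) W) x"
    have V: "block_positive (m + 2) d ?V" by (rule block_positive_slice[OF W])
    then have "frob2 (idx (m + 2) d) ?V \<le> R * (Re (tr (idx (m + 2) d) ?V))\<^sup>2"
      unfolding R_def using Suc.prems by (intro Suc.IH) auto
    then have "sqrt (frob2 (idx (m + 2) d) ?V) \<le> sqrt (R * (Re (tr (idx (m + 2) d) ?V))\<^sup>2)" by simp
    then show "sqrt (frob2 (idx (m + 2) d) ?V) \<le> sqrt R * Re (tr (idx (m + 2) d) ?V)"
      using Re_tr_nonneg_of_block_positive[OF V] by (simp add: real_sqrt_mult)
  qed (use dpos R in auto)
  then show ?case using R by (simp add: R_def)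
qed

subsection \<open>States, joint numerical ranges and volumes\<close>

lemma psd_on_iff_sesq: "psd_on I A \<longleftrightarrow> (\<forall>v. Im (sesq I A v v) = 0 \<and> 0 \<le> Re (sesq I A v v))"
  unfolding psd_on_def sesq_def ..

lemma sesq_single:
  assumes "finite I" "a \<in> I"
  shows "sesq I A (\<lambda>k. if k = a then 1 else 0) (\<lambda>k. if k = a then 1 else 0) = A a a"
  unfolding sesq_def using assms by (simp add: sum_single[where i = a])

lemma cmod_entry_sq_le:
  assumes I: "finite I" "a \<in> I" "b \<in> I" and herm: "hermitian_on I A"
    and nonneg: "\<And>v. 0 \<le> Re (sesq I A v v)"
  shows "(cmod (A a b))\<^sup>2 \<le> Re (A a a) * Re (A b b)"
proof (cases "a = b")
  case True
  have "A a a = cnj (A a a)" using herm I unfolding hermitian_on_def by blast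
  then have "Im (A a a) = 0" by (simp add: complex_eq_iff)
  then show ?thesis using True unfolding cmod_power2 by (simp add: power2_eq_square)
next
  case False
  have adj: "A b a = cnj (A a b)" using herm I unfolding hermitian_on_def by blast
  show ?thesis
  proof (rule cmod_sq_le_of_form_nonneg)
    fix \<alpha> \<beta> :: complex
    define v where "v k = (if k = a then \<alpha> else if k = b then \<beta> else 0)" for k
    have "sesq I A v v = of_real ((cmod \<alpha>)\<^sup>2) * A a a + of_real ((cmod \<beta>)\<^sup>2) * A b b
          + (cnj \<alpha> * \<beta> * A a b + cnj (cnj \<alpha> * \<beta> * A a b))"
      unfolding sesq_def v_def using I False adj
      by (simp add: sum_pair[where i = a and j = b] complex_norm_square algebra_simps del: of_real_power)
    then show "0 \<le> (cmod \<alpha>)\<^sup>2 * Re (A a a) + (cmod \<beta>)\<^sup>2 * Re (A b b) + 2 * Re (cnj \<alpha> * \<beta> * A a b)"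
      using nonneg[of v] unfolding complex_add_cnj by (simp del: of_real_power)
  qed
qed

text \<open>The 2x2 principal minors bound each entry of a state, and the sum of these bounds
  factors into the squared trace.\<close>

lemma frob2_density_le:
  assumes "finite I" "density_on I \<rho>"
  shows "frob2 I \<rho> \<le> 1"
proof -
  have "frob2 I \<rho> \<le> (\<Sum>a\<in>I. \<Sum>b\<in>I. Re (\<rho> a a) * Re (\<rho> b b))"
    unfolding frob2_def using assms
    by (intro sum_mono cmod_entry_sq_le) (auto simp: density_on_def psd_on_iff_sesq)
  also have "\<dots> = (Re (tr I \<rho>))\<^sup>2" by (simp add: tr_def power2_eq_square sum_product)
  finally show ?thesis using assms(2) by (simp add: density_on_def)
qed

lemma density_on_rank_one:
  assumes "(\<Sum>a\<in>I. (cmod (v a))\<^sup>2) = 1"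
  shows "density_on I (\<lambda>a b. v a * cnj (v b))"
  unfolding density_on_def
proof (intro conjI)
  show "hermitian_on I (\<lambda>a b. v a * cnj (v b))" by (simp add: hermitian_on_def)
  have "sesq I (\<lambda>a b. v a * cnj (v b)) w w = of_real ((cmod (\<Sum>a\<in>I. cnj (w a) * v a))\<^sup>2)" for w
    unfolding sesq_def complex_norm_square cnj_sum sum_product by (simp add: mult_ac)
  then show "psd_on I (\<lambda>a b. v a * cnj (v b))" unfolding psd_on_iff_sesq by (simp del: of_real_power)
  have "tr I (\<lambda>a b. v a * cnj (v b)) = of_real (\<Sum>a\<in>I. (cmod (v a))\<^sup>2)"
    unfolding tr_def of_real_sum complex_norm_square ..
  then show "tr I (\<lambda>a b. v a * cnj (v b)) = 1" using assms by simp
qed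

lemma tr_mprod_rank_one: "tr I (mprod I (\<lambda>a b. v a * cnj (v b)) A) = sesq I A v v"
  unfolding tr_def mprod_def sesq_def by (subst sum.swap) (simp add: mult_ac)

lemma Re_tr_mprod_sq_le: "(Re (tr I (mprod I A B)))\<^sup>2 \<le> frob2 I A * frob2 I B"
proof -
  have "\<bar>Re (tr I (mprod I A B))\<bar> \<le> cmod (tr I (mprod I A B))" by (rule abs_Re_le_cmod)
  also have "\<dots> \<le> (\<Sum>a\<in>I. \<Sum>b\<in>I. cmod (A a b) * cmod (B b a))"
    unfolding tr_def mprod_def norm_mult[symmetric] by (intro order_trans[OF norm_sum] sum_mono norm_sum)
  also have "\<dots> = (\<Sum>(a, b)\<in>I \<times> I. cmod (A a b) * cmod (B b a))"
    by (simp add: sum.cartesian_product)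
  finally have "\<bar>Re (tr I (mprod I A B))\<bar>\<^sup>2 \<le> (\<Sum>(a, b)\<in>I \<times> I. cmod (A a b) * cmod (B b a))\<^sup>2"
    by (intro power_mono) auto
  also have "\<dots> \<le> (\<Sum>(a, b)\<in>I \<times> I. (cmod (A a b))\<^sup>2) * (\<Sum>(a, b)\<in>I \<times> I. (cmod (B b a))\<^sup>2)"
    using Cauchy_Schwarz_ineq_sum[of "\<lambda>(a, b). cmod (A a b)" "\<lambda>(a, b). cmod (B b a)" "I \<times> I"]
    by (simp add: case_prod_unfold)
  also have "(\<Sum>(a, b)\<in>I \<times> I. (cmod (B b a))\<^sup>2) = frob2 I B"
    unfolding frob2_def sum.cartesian_product[symmetric] by (rule sum.swap)
  finally show ?thesis by (simp add: frob2_def sum.cartesian_product)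
qed

section \<open>Traceless parts and states near the maximally mixed one\<close>

lemma frob2_diff_scalar:
  assumes "finite I"
  shows "frob2 I (\<lambda>a b. A a b - (if a = b then of_real c else 0)) = frob2 I A - 2 * c * Re (tr I A) + c\<^sup>2 * card I"
proof -
  have "(cmod (A a b - (if a = b then of_real c else 0)))\<^sup>2
      = (cmod (A a b))\<^sup>2 + (if a = b then c\<^sup>2 - 2 * c * Re (A a a) else 0)" for a b
    unfolding cmod_power2 by (simp add: power2_eq_square algebra_simps)
  then show ?thesis
    unfolding frob2_def tr_def using assms
    by (simp add: sum.distrib sum_subtractf sum_distrib_left)
qed

lemma tr_mprod_diff_scalar:
  assumes "finite I"
  shows "tr I (mprod I (\<lambda>a b. A a b - (if a = b then c else 0)) (\<lambda>a b. B a b - (if a = b then e else 0)))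
    = tr I (mprod I A B) - e * tr I A - c * tr I B + c * e * of_nat (card I)"
proof -
  have "(A a b - (if a = b then c else 0)) * (B b a - (if b = a then e else 0))
      = A a b * B b a + (if a = b then c * e - e * A a a - c * B a a else 0)" for a b
    by (simp add: algebra_simps)
  then show ?thesis
    unfolding tr_def mprod_def using assms
    by (simp add: sum.distrib sum_subtractf sum_distrib_left mult_ac)
qed

text \<open>The expression is the expectation of \<open>W\<close> in \<tau> + \<epsilon> (\<rho> -
  \<tau>), with \<tau> maximally mixed. Its second summand involves only the traceless parts of
  \<rho> and \<open>W\<close>, whose squared norms are at most 1 - 1/D and (R - 1/D) T^2; by
  Cauchy-Schwarz it cannot outweigh T/D.\<close>

lemma shrunken_state_expectation_nonneg:
  fixes R \<epsilon> :: real
  assumes I: "finite I" "I \<noteq> {}" and \<rho>: "density_on I \<rho>"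
    and W: "frob2 I W \<le> R * (Re (tr I W))\<^sup>2" "0 \<le> Re (tr I W)"
    and \<epsilon>: "0 \<le> \<epsilon>" "\<epsilon>\<^sup>2 * ((R * card I - 1) * (real (card I) - 1)) \<le> 1"
  shows "0 \<le> Re (tr I W) / card I + \<epsilon> * (Re (tr I (mprod I \<rho> W)) - Re (tr I W) / card I)"
proof -
  define D where "D = real (card I)"
  have D: "D \<ge> 1" using I by (simp add: D_def Suc_le_eq card_gt_0_iff)
  define T where "T = Re (tr I W)"
  define x where "x = Re (tr I (mprod I \<rho> W)) - T / D"
  let ?\<rho> = "\<lambda>a b. \<rho> a b - (if a = b then of_real (1 / D) else 0)"
  let ?W = "\<lambda>a b. W a b - (if a = b then of_real (T / D) else 0)"
  have tr1: "tr I \<rho> = 1" using \<rho> by (simp add: density_on_def)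
  have "Re (tr I (mprod I ?\<rho> ?W)) = x"
    unfolding tr_mprod_diff_scalar[OF I(1)] tr1 x_def using D by (simp add: T_def[symmetric] D_def[symmetric])
  then have "x\<^sup>2 \<le> frob2 I ?\<rho> * frob2 I ?W" using Re_tr_mprod_sq_le[of I ?\<rho> ?W] by simp
  also have "\<dots> \<le> (1 - 1 / D) * (R * T\<^sup>2 - T\<^sup>2 / D)"
  proof (rule mult_mono)
    have "frob2 I ?\<rho> = frob2 I \<rho> - 1 / D"
      unfolding frob2_diff_scalar[OF I(1)] tr1 using D by (simp add: D_def[symmetric] power2_eq_square field_simps)
    then show "frob2 I ?\<rho> \<le> 1 - 1 / D" using frob2_density_le[OF I(1) \<rho>] by simp
    have "frob2 I ?W = frob2 I W - T\<^sup>2 / D"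
      unfolding frob2_diff_scalar[OF I(1)] T_def[symmetric] using D
      by (simp add: D_def[symmetric] power2_eq_square field_simps)
    then show "frob2 I ?W \<le> R * T\<^sup>2 - T\<^sup>2 / D" using W(1) by (simp add: T_def)
  qed (use D in auto)
  also have "\<dots> = ((R * D - 1) * (D - 1)) * (T / D)\<^sup>2"
    using D by (simp add: power2_eq_square field_simps)
  finally have "\<epsilon>\<^sup>2 * x\<^sup>2 \<le> \<epsilon>\<^sup>2 * (((R * D - 1) * (D - 1)) * (T / D)\<^sup>2)"
    by (intro mult_left_mono) auto
  also have "\<dots> = (\<epsilon>\<^sup>2 * ((R * D - 1) * (D - 1))) * (T / D)\<^sup>2" by (simp only: mult.assoc)
  also have "\<dots> \<le> 1 * (T / D)\<^sup>2"
    by (intro mult_right_mono) (use \<epsilon>(2) D in \<open>auto simp: D_def\<close>)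
  finally have "(\<epsilon> * x)\<^sup>2 \<le> (T / D)\<^sup>2" by (simp add: power_mult_distrib)
  moreover have "0 \<le> T / D" using W(2) D by (simp add: T_def)
  ultimately have "\<bar>\<epsilon> * x\<bar> \<le> T / D" using abs_le_square_iff[of "\<epsilon> * x" "T / D"] by simp
  then show ?thesis unfolding x_def T_def D_def by linarith
qed

text \<open>Its expectation in a state is the affine functional \<open>c \<bullet> x - e\<close> of
  the expectation vector \<open>x\<close>, which turns a half-space of R^k into an operator
  inequality.\<close>

definition witness :: "'i set \<Rightarrow> ('k::finite \<Rightarrow> 'i op) \<Rightarrow> real^'k \<Rightarrow> real \<Rightarrow> 'i op" where
  "witness I A c e = (\<lambda>a b. (\<Sum>j\<in>UNIV. of_real (c $ j) * A j a b) - (if a = b then of_real e else 0))"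

lemma witness_hermitian:
  assumes "\<And>j. hermitian_on I (A j)"
  shows "hermitian_on I (witness I A c e)"
  unfolding hermitian_on_def
proof (intro ballI)
  fix a b assume ab: "a \<in> I" "b \<in> I"
  have "A j a b = cnj (A j b a)" for j using assms ab unfolding hermitian_on_def by blast
  then have "(\<Sum>j\<in>UNIV. of_real (c $ j) * A j a b) = (\<Sum>j\<in>UNIV. of_real (c $ j) * cnj (A j b a))" by simp
  then show "witness I A c e a b = cnj (witness I A c e b a)" unfolding witness_def by simp
qed

lemma tr_mprod_witness:
  assumes "finite I"
  shows "tr I (mprod I \<rho> (witness I A c e))
    = (\<Sum>j\<in>UNIV. of_real (c $ j) * tr I (mprod I \<rho> (A j))) - of_real e * tr I \<rho>"
proof -
  have "\<rho> a b * witness I A c e b a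
      = (\<Sum>j\<in>UNIV. of_real (c $ j) * (\<rho> a b * A j b a)) - (if a = b then of_real e * \<rho> a a else 0)" for a b
    unfolding witness_def by (simp add: algebra_simps sum_distrib_left)
  then have "tr I (mprod I \<rho> (witness I A c e))
      = (\<Sum>a\<in>I. \<Sum>b\<in>I. \<Sum>j\<in>UNIV. of_real (c $ j) * (\<rho> a b * A j b a)) - of_real e * tr I \<rho>"
    unfolding tr_def mprod_def using assms by (simp add: sum_subtractf sum_distrib_left)
  also have "(\<Sum>a\<in>I. \<Sum>b\<in>I. \<Sum>j\<in>UNIV. of_real (c $ j) * (\<rho> a b * A j b a))
      = (\<Sum>j\<in>UNIV. \<Sum>a\<in>I. \<Sum>b\<in>I. of_real (c $ j) * (\<rho> a b * A j b a))"
    (is "?l = ?r")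
  proof -
    have "?l = (\<Sum>a\<in>I. \<Sum>j\<in>UNIV. \<Sum>b\<in>I. of_real (c $ j) * (\<rho> a b * A j b a))"
      by (intro sum.cong refl sum.swap)
    also have "\<dots> = ?r" by (rule sum.swap)
    finally show ?thesis .
  qed
  finally show ?thesis unfolding tr_def mprod_def by (simp add: sum_distrib_left)
qed

lemma Re_tr_mprod_witness:
  assumes "finite I" "tr I \<rho> = 1"
  shows "Re (tr I (mprod I \<rho> (witness I A c e))) = c \<bullet> expvals I A \<rho> - e"
  unfolding tr_mprod_witness[OF assms(1)] assms(2) expvals_def inner_vec_def by simp

lemma tr_mprod_scalar:
  assumes "finite I"
  shows "tr I (mprod I (\<lambda>a b. if a = b then c else 0) A) = c * tr I A"
proof -
  have "(if a = b then c else 0) * A b a = (if a = b then c * A a a else 0)" for a b by simp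
  then show ?thesis unfolding tr_def mprod_def using assms by (simp add: sum_distrib_left)
qed

section \<open>Product vectors and separable states\<close>

lemma sum_prod_norm_idx:
  "(\<Sum>a\<in>idx n d. (cmod (\<Prod>i<n. v i (a i)))\<^sup>2) = (\<Prod>i<n. \<Sum>m<d i. (cmod (v i m))\<^sup>2)"
  unfolding idx_def by (subst prod_sum_PiE) (auto simp: prod_norm[symmetric] prod_power_distrib)

lemma separable_product_state: "product_state n d \<rho> \<Longrightarrow> separable n d \<rho>"
  unfolding separable_def
  by (rule exI[of _ 1], rule exI[of _ "\<lambda>_. 1"], rule exI[of _ "\<lambda>_. \<rho>"]) auto

lemma expvals_product_vector_in_jnr_sep:
  assumes "\<And>i. i < n \<Longrightarrow> (\<Sum>m<d i. (cmod (v i m))\<^sup>2) = 1"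
  defines "\<rho> \<equiv> \<lambda>a b. (\<Prod>i<n. v i (a i)) * cnj (\<Prod>i<n. v i (b i))"
  shows "density_on (idx n d) \<rho>" "expvals (idx n d) A \<rho> \<in> jnr_sep n d A"
proof -
  show *: "density_on (idx n d) \<rho>"
    unfolding \<rho>_def by (rule density_on_rank_one) (simp add: sum_prod_norm_idx assms(1))
  have "product_state n d \<rho>"
    unfolding product_state_def
    by (rule exI[of _ "\<lambda>i m m'. v i m * cnj (v i m')"])
      (auto simp: \<rho>_def prod.distrib assms(1) intro!: density_on_rank_one)
  then show "expvals (idx n d) A \<rho> \<in> jnr_sep n d A"
    unfolding jnr_sep_def using * separable_product_state by blast
qed

lemma sesq_scale: "sesq I A (\<lambda>a. c * v a) (\<lambda>a. c * v a) = of_real ((cmod c)\<^sup>2) * sesq I A v v"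
  unfolding sesq_def complex_norm_square by (simp add: sum_distrib_left mult_ac)

text \<open>Once the factors are normalised, the expectation vector of the pure product state is a
  point of \<open>jnr_sep\<close>, inside the half-space. If some factor is zero, so is the whole
  product vector.\<close>

lemma block_positive_witness:
  assumes herm: "\<And>j. hermitian_on (idx n d) (A j)" and pos: "\<And>x. x \<in> jnr_sep n d A \<Longrightarrow> e \<le> c \<bullet> x"
  shows "block_positive n d (witness (idx n d) A c e)"
  unfolding block_positive_def
proof (intro conjI allI witness_hermitian herm)
  fix v :: "nat \<Rightarrow> nat \<Rightarrow> complex"
  define N where "N i = (\<Sum>m<d i. (cmod (v i m))\<^sup>2)" for i
  let ?I = "idx n d" and ?W = "witness (idx n d) A c e"
  show "0 \<le> Re (sesq ?I ?W (\<lambda>a. \<Prod>i<n. v i (a i)) (\<lambda>a. \<Prod>i<n. v i (a i)))"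
  proof (cases "\<exists>i<n. N i = 0")
    case True
    then have "(\<Sum>a\<in>?I. (cmod (\<Prod>i<n. v i (a i)))\<^sup>2) = 0"
      unfolding sum_prod_norm_idx N_def by (auto intro: prod_zero)
    then have "(\<Prod>i<n. v i (a i)) = 0" if "a \<in> ?I" for a
      using that by (subst (asm) sum_nonneg_eq_0_iff) auto
    then have "sesq ?I ?W (\<lambda>a. \<Prod>i<n. v i (a i)) (\<lambda>a. \<Prod>i<n. v i (a i)) = 0"
      unfolding sesq_def by (intro sum.neutral ballI) (simp del: prod_zero_iff)
    then show ?thesis by simp
  next
    case False
    have N: "0 < N i" if "i < n" for i
    proof -
      have "0 \<le> N i" unfolding N_def by (intro sum_nonneg) auto
      then show ?thesis using False that by (metis order_le_less)
    qed
    define u where "u i m = v i m / of_real (sqrt (N i))" for i m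
    have u1: "(\<Sum>m<d i. (cmod (u i m))\<^sup>2) = 1" if "i < n" for i
      unfolding u_def using N[OF that] N_def[of i]
      by (simp add: norm_divide power_divide flip: sum_divide_distrib)
    define s where "s = (\<Prod>i<n. complex_of_real (sqrt (N i)))"
    have "(\<Prod>i<n. v i (a i)) = s * (\<Prod>i<n. u i (a i))" for a
      unfolding s_def prod.distrib[symmetric] u_def
      by (intro prod.cong refl) (use N in force)
    then have "sesq ?I ?W (\<lambda>a. \<Prod>i<n. v i (a i)) (\<lambda>a. \<Prod>i<n. v i (a i))
        = of_real ((cmod s)\<^sup>2) * sesq ?I ?W (\<lambda>a. \<Prod>i<n. u i (a i)) (\<lambda>a. \<Prod>i<n. u i (a i))"
      by (simp only: sesq_scale)
    moreover have "0 \<le> Re (sesq ?I ?W (\<lambda>a. \<Prod>i<n. u i (a i)) (\<lambda>a. \<Prod>i<n. u i (a i)))"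
      unfolding tr_mprod_rank_one[symmetric]
      using expvals_product_vector_in_jnr_sep[where v = u, OF u1] pos
      by (subst Re_tr_mprod_witness) (auto simp: density_on_def)
    ultimately show ?thesis by (simp del: of_real_power)
  qed
qed

section \<open>Convexity, boundedness and interior of the joint numerical ranges\<close>

lemma density_on_convex_comb:
  assumes "density_on I \<rho>" "density_on I \<sigma>" and st: "0 \<le> s" "0 \<le> t" "s + t = (1::real)"
  shows "density_on I (\<lambda>a b. of_real s * \<rho> a b + of_real t * \<sigma> a b)"
  unfolding density_on_def
proof (intro conjI)
  show "hermitian_on I (\<lambda>a b. of_real s * \<rho> a b + of_real t * \<sigma> a b)"
    unfolding hermitian_on_def
  proof (intro ballI)
    fix a b assume "a \<in> I" "b \<in> I"
    then have "\<rho> a b = cnj (\<rho> b a)" "\<sigma> a b = cnj (\<sigma> b a)"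
      using assms(1,2) unfolding density_on_def hermitian_on_def by blast+
    then show "of_real s * \<rho> a b + of_real t * \<sigma> a b = cnj (of_real s * \<rho> b a + of_real t * \<sigma> b a)" by simp
  qed
  have "sesq I (\<lambda>a b. of_real s * \<rho> a b + of_real t * \<sigma> a b) v v = of_real s * sesq I \<rho> v v + of_real t * sesq I \<sigma> v v" for v
    unfolding sesq_def by (simp add: sum_distrib_left sum.distrib algebra_simps)
  then show "psd_on I (\<lambda>a b. of_real s * \<rho> a b + of_real t * \<sigma> a b)"
    using assms unfolding density_on_def psd_on_iff_sesq by simp
  have "tr I (\<lambda>a b. of_real s * \<rho> a b + of_real t * \<sigma> a b) = of_real s * tr I \<rho> + of_real t * tr I \<sigma>"
    unfolding tr_def by (simp add: sum_distrib_left sum.distrib)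
  then show "tr I (\<lambda>a b. of_real s * \<rho> a b + of_real t * \<sigma> a b) = 1"
    using assms unfolding density_on_def by (simp flip: of_real_add)
qed

lemma separable_convex_comb:
  assumes "separable n d \<rho>" "separable n d \<sigma>" and st: "0 \<le> s" "0 \<le> t" "s + t = (1::real)"
  shows "separable n d (\<lambda>a b. of_real s * \<rho> a b + of_real t * \<sigma> a b)"
proof -
  obtain m :: nat and w \<tau> where \<rho>: "\<forall>l<m. 0 \<le> w l \<and> product_state n d (\<tau> l)" "(\<Sum>l<m. w l) = (1::real)"
    "\<forall>a\<in>idx n d. \<forall>b\<in>idx n d. \<rho> a b = (\<Sum>l<m. complex_of_real (w l) * \<tau> l a b)"
    using assms(1) unfolding separable_def by blast
  obtain m' :: nat and w' \<tau>' where \<sigma>: "\<forall>l<m'. 0 \<le> w' l \<and> product_state n d (\<tau>' l)" "(\<Sum>l<m'. w' l) = (1::real)"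
    "\<forall>a\<in>idx n d. \<forall>b\<in>idx n d. \<sigma> a b = (\<Sum>l<m'. complex_of_real (w' l) * \<tau>' l a b)"
    using assms(2) unfolding separable_def by blast
  \<comment> \<open>The two decompositions are concatenated, the second one shifted by
    \<open>m\<close>.\<close>
  define W where "W l = (if l < m then s * w l else t * w' (l - m))" for l
  define T where "T l = (if l < m then \<tau> l else \<tau>' (l - m))" for l
  have split: "(\<Sum>l<m + m'. f l) = (\<Sum>l<m. f l) + (\<Sum>l<m'. f (m + l))" for f :: "nat \<Rightarrow> 'b::comm_monoid_add"
    by (induction m') (auto simp: add.assoc)
  show ?thesis
    unfolding separable_def
  proof (intro exI conjI)
    show "\<forall>l<m + m'. 0 \<le> W l \<and> product_state n d (T l)"
      using \<rho>(1) \<sigma>(1) st unfolding W_def T_def by auto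
    show "(\<Sum>l<m + m'. W l) = 1"
      unfolding split W_def using \<rho>(2) \<sigma>(2) st by (simp flip: sum_distrib_left)
    show "\<forall>a\<in>idx n d. \<forall>b\<in>idx n d. of_real s * \<rho> a b + of_real t * \<sigma> a b
        = (\<Sum>l<m + m'. complex_of_real (W l) * T l a b)"
      unfolding split W_def T_def using \<rho>(3) \<sigma>(3) by (simp add: sum_distrib_left mult.assoc)
  qed
qed

lemma expvals_convex_comb:
  "expvals I A (\<lambda>a b. of_real s * \<rho> a b + of_real t * \<sigma> a b) = s *\<^sub>R expvals I A \<rho> + t *\<^sub>R expvals I A \<sigma>"
proof -
  have "tr I (mprod I (\<lambda>a b. of_real s * \<rho> a b + of_real t * \<sigma> a b) B)
    = of_real s * tr I (mprod I \<rho> B) + of_real t * tr I (mprod I \<sigma> B)" for B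
    unfolding tr_def mprod_def by (simp add: sum_distrib_left sum.distrib algebra_simps)
  then show ?thesis unfolding expvals_def by (simp add: vec_eq_iff)
qed

lemma convex_jnr: "convex (jnr n d A)"
proof (rule convexI)
  fix x y and s t :: real
  assume "x \<in> jnr n d A" "y \<in> jnr n d A" and st: "0 \<le> s" "0 \<le> t" "s + t = 1"
  then obtain \<rho> \<sigma> where "x = expvals (idx n d) A \<rho>" "y = expvals (idx n d) A \<sigma>"
    and ds: "density_on (idx n d) \<rho>" "density_on (idx n d) \<sigma>"
    unfolding jnr_def by blast
  then have "s *\<^sub>R x + t *\<^sub>R y = expvals (idx n d) A (\<lambda>a b. of_real s * \<rho> a b + of_real t * \<sigma> a b)"
    by (simp only: expvals_convex_comb)
  with density_on_convex_comb[OF ds st] show "s *\<^sub>R x + t *\<^sub>R y \<in> jnr n d A"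
    unfolding jnr_def by blast
qed

lemma convex_jnr_sep: "convex (jnr_sep n d A)"
proof (rule convexI)
  fix x y and s t :: real
  assume "x \<in> jnr_sep n d A" "y \<in> jnr_sep n d A" and st: "0 \<le> s" "0 \<le> t" "s + t = 1"
  then obtain \<rho> \<sigma> where "x = expvals (idx n d) A \<rho>" "y = expvals (idx n d) A \<sigma>"
    and ds: "density_on (idx n d) \<rho>" "density_on (idx n d) \<sigma>"
    and sep: "separable n d \<rho>" "separable n d \<sigma>"
    unfolding jnr_sep_def by blast
  then have "s *\<^sub>R x + t *\<^sub>R y = expvals (idx n d) A (\<lambda>a b. of_real s * \<rho> a b + of_real t * \<sigma> a b)"
    by (simp only: expvals_convex_comb)
  with density_on_convex_comb[OF ds st] separable_convex_comb[OF sep st]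
  show "s *\<^sub>R x + t *\<^sub>R y \<in> jnr_sep n d A"
    unfolding jnr_sep_def by blast
qed

lemma jnr_sep_subset_jnr: "jnr_sep n d A \<subseteq> jnr n d A"
  unfolding jnr_sep_def jnr_def by blast

lemma bounded_jnr: "bounded (jnr n d A)"
proof (rule boundedI)
  fix x assume "x \<in> jnr n d A"
  then obtain \<rho> where x: "x = expvals (idx n d) A \<rho>" and \<rho>: "density_on (idx n d) \<rho>"
    unfolding jnr_def by blast
  have "\<bar>x $ j\<bar> \<le> sqrt (frob2 (idx n d) (A j))" for j
  proof (rule real_le_rsqrt)
    have "(x $ j)\<^sup>2 \<le> frob2 (idx n d) \<rho> * frob2 (idx n d) (A j)"
      unfolding x expvals_def using Re_tr_mprod_sq_le by simp
    also have "\<dots> \<le> 1 * frob2 (idx n d) (A j)"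
      by (intro mult_right_mono frob2_density_le \<rho>) auto
    finally show "\<bar>x $ j\<bar>\<^sup>2 \<le> frob2 (idx n d) (A j)" by simp
  qed
  then show "norm x \<le> (\<Sum>j\<in>UNIV. sqrt (frob2 (idx n d) (A j)))"
    by (intro order_trans[OF norm_le_l1_cart] sum_mono)
qed

text \<open>A convex set without interior lies in a hyperplane, whose witness then has expectation
  zero in every state. Its form vanishes on unit vectors, hence everywhere, so all its entries are
  zero, and linear independence of the traceless parts forces \<open>c\<close> to be zero.\<close>

lemma interior_jnr_nonempty:
  assumes D: "idx n d \<noteq> {}" and adm: "admissible n d A"
  shows "interior (jnr n d A) \<noteq> {}"
proof
  let ?I = "idx n d"
  assume "interior (jnr n d A) = {}"
  then obtain c e where c: "c \<noteq> 0" and ce: "jnr n d A \<subseteq> {x. c \<bullet> x = e}"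
    using empty_interior_subset_hyperplane[OF convex_jnr] by metis
  let ?W = "witness ?I A c e"
  have W0: "Re (tr ?I (mprod ?I \<rho> ?W)) = 0" if "density_on ?I \<rho>" for \<rho>
  proof -
    have "c \<bullet> expvals ?I A \<rho> = e" using ce that unfolding jnr_def by blast
    then show ?thesis using that by (simp add: Re_tr_mprod_witness density_on_def)
  qed
  have s0: "Re (sesq ?I ?W v v) = 0" for v
  proof -
    define N where "N = (\<Sum>a\<in>?I. (cmod (v a))\<^sup>2)"
    have N: "0 \<le> N" unfolding N_def by (intro sum_nonneg) auto
    show ?thesis
    proof (cases "N = 0")
      case True
      then have "v a = 0" if "a \<in> ?I" for a
        using that unfolding N_def by (subst (asm) sum_nonneg_eq_0_iff) auto
      then show ?thesis by (simp add: sesq_def)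
    next
      case False
      define u where "u a = v a / of_real (sqrt N)" for a
      have "(\<Sum>a\<in>?I. (cmod (u a))\<^sup>2) = 1"
        unfolding u_def using N False N_def
        by (simp add: norm_divide power_divide flip: sum_divide_distrib)
      then have "Re (sesq ?I ?W u u) = 0"
        using W0[OF density_on_rank_one] by (simp only: tr_mprod_rank_one)
      moreover have "v = (\<lambda>a. of_real (sqrt N) * u a)" unfolding u_def using N False by simp
      ultimately show ?thesis using sesq_scale[of ?I ?W "of_real (sqrt N)" u] by (simp del: of_real_power)
    qed
  qed
  have herm: "hermitian_on ?I ?W" using adm by (intro witness_hermitian) (simp add: admissible_def)
  have diag: "Re (?W a a) = 0" if "a \<in> ?I" for a
    using s0[of "\<lambda>k. if k = a then 1 else 0"] that by (simp add: sesq_single)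
  have zero: "?W a b = 0" if "a \<in> ?I" "b \<in> ?I" for a b
    using cmod_entry_sq_le[OF finite_idx that herm] s0 diag that by simp
  \<comment> \<open>The vanishing trace determines \<open>e\<close> and so identifies the witness
    with the combination of the traceless parts with coefficients \<open>c\<close>.\<close>
  have "tr ?I ?W = 0" unfolding tr_def using zero by simp
  moreover have "tr ?I ?W = (\<Sum>j\<in>UNIV. of_real (c $ j) * tr ?I (A j)) - of_real e * of_nat (card ?I)"
    unfolding tr_def witness_def
    by (simp add: sum_subtractf sum_distrib_left mult.commute sum.swap[of _ UNIV])
  ultimately have e: "(\<Sum>j\<in>UNIV. of_real (c $ j) * tr ?I (A j)) = of_real e * of_nat (card ?I)" by simp
  have "(\<Sum>j\<in>UNIV. complex_of_real (c $ j) * traceless ?I (A j) a b) = ?W a b" for a b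
  proof -
    have "(\<Sum>j\<in>UNIV. complex_of_real (c $ j) * traceless ?I (A j) a b)
      = (\<Sum>j\<in>UNIV. of_real (c $ j) * A j a b)
        - (if a = b then (\<Sum>j\<in>UNIV. of_real (c $ j) * tr ?I (A j)) / of_nat (card ?I) else 0)"
      unfolding traceless_def by (simp add: algebra_simps sum_subtractf sum_divide_distrib)
    then show ?thesis unfolding witness_def e using D by simp
  qed
  then have "\<forall>a\<in>?I. \<forall>b\<in>?I. (\<Sum>j\<in>UNIV. complex_of_real (c $ j) * traceless ?I (A j) a b) = 0"
    using zero by simp
  then have "\<forall>j. c $ j = 0" using adm unfolding admissible_def lin_indep_ops_def by blast
  then show False using c by (simp add: vec_eq_iff)
qed

section \<open>Volume comparison and separating hyperplanes\<close>

text \<open>A homothety scales volume by the k-th power of its ratio, and passing to the closure of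
  \<open>S\<close> is free because a convex set has negligible frontier. The nonempty interior makes
  the volume of \<open>L\<close> positive, so the quotient is not the default value 0 of a division
  by zero.\<close>

lemma measure_ratio_ge_of_homothety:
  fixes S L :: "(real^'k) set"
  assumes "convex S" "bounded S" "convex L" "bounded L" "interior L \<noteq> {}" "0 \<le> \<epsilon>"
    and sub: "\<And>x. x \<in> L \<Longrightarrow> z + \<epsilon> *\<^sub>R (x - z) \<in> closure S"
  shows "\<epsilon> ^ CARD('k) \<le> measure lebesgue S / measure lebesgue L"
proof -
  have L: "L \<in> lmeasurable" using assms by (simp add: measurable_convex)
  then have "measure lebesgue L \<noteq> 0"
    using negligible_iff_measure0[OF L] negligible_convex_interior[OF assms(3)] assms(5) by simp
  then have pos: "0 < measure lebesgue L" by (simp add: zero_less_measure_iff)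
  let ?M = "(\<lambda>x. \<epsilon> *\<^sub>R x + (z - \<epsilon> *\<^sub>R z)) ` L"
  have aff: "measure lebesgue ?M = \<epsilon> ^ CARD('k) * measure lebesgue L"
    using measure_lebesgue_affine[of \<epsilon> "z - \<epsilon> *\<^sub>R z" L] assms(6) by simp
  have "?M \<subseteq> closure S" using sub by (auto simp: algebra_simps)
  moreover have "?M \<in> lmeasurable"
  proof (rule measurable_convex)
    show "convex ?M"
      using convex_affinity[OF assms(3), of "z - \<epsilon> *\<^sub>R z" \<epsilon>] by (simp add: add.commute)
    show "bounded ?M" using \<open>?M \<subseteq> closure S\<close> bounded_closure[OF assms(2)] bounded_subset by blast
  qed
  ultimately have "measure lebesgue ?M \<le> measure lebesgue (closure S)"
    using assms(2) by (intro measure_mono_fmeasurable) (auto simp: fmeasurableD lmeasurable_closure)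
  also have "\<dots> = measure lebesgue S"
    using assms(1,2) by (intro measure_closure negligible_convex_frontier)
  finally show ?thesis unfolding aff using pos by (simp add: le_divide_eq)
qed

text \<open>If some shrunken point lay outside the closure of the separable range, a strictly
  separating hyperplane would give a block-positive witness that is negative at that point, contrary
  to the expectation bound.\<close>

lemma mu_ge_of_frob2_bound:
  fixes \<epsilon> R :: real
  assumes D: "0 < totdim n d"
    and bound: "\<And>W. block_positive n d W \<Longrightarrow> frob2 (idx n d) W \<le> R * (Re (tr (idx n d) W))\<^sup>2"
    and \<epsilon>: "0 \<le> \<epsilon>" "\<epsilon>\<^sup>2 * ((R * totdim n d - 1) * (real (totdim n d) - 1)) \<le> 1"
  shows "ereal (\<epsilon> ^ CARD('k::finite)) \<le> mu n d TYPE('k)"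
  unfolding mu_def
proof (rule INF_greatest)
  let ?I = "idx n d" and ?D = "totdim n d"
  fix A :: "'k \<Rightarrow> (nat \<Rightarrow> nat) op" assume "A \<in> {A. admissible n d A}"
  then have adm: "admissible n d A" by simp
  have I: "?I \<noteq> {}" using D card_idx[of n d] by auto
  define \<tau> :: "(nat \<Rightarrow> nat) op" where "\<tau> = (\<lambda>a b. if a = b then of_real (1 / ?D) else 0)"
  define z where "z = expvals ?I A \<tau>"
  have "\<epsilon> ^ CARD('k) \<le> measure lebesgue (jnr_sep n d A) / measure lebesgue (jnr n d A)"
  proof (rule measure_ratio_ge_of_homothety[where z = z])
    fix x assume "x \<in> jnr n d A"
    then obtain \<rho> where x: "x = expvals ?I A \<rho>" and \<rho>: "density_on ?I \<rho>"
      unfolding jnr_def by blast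
    show "z + \<epsilon> *\<^sub>R (x - z) \<in> closure (jnr_sep n d A)"
    proof (rule ccontr)
      assume "z + \<epsilon> *\<^sub>R (x - z) \<notin> closure (jnr_sep n d A)"
      then obtain c e where c: "c \<bullet> (z + \<epsilon> *\<^sub>R (x - z)) < e" "\<forall>y\<in>closure (jnr_sep n d A). e < c \<bullet> y"
        using separating_hyperplane_closed_point[of "closure (jnr_sep n d A)"] convex_jnr_sep
        by (metis closed_closure convex_closure)
      define W where "W = witness ?I A c e"
      have "block_positive n d W"
        unfolding W_def using adm c(2) closure_subset[of "jnr_sep n d A"]
        by (intro block_positive_witness) (auto simp: admissible_def less_imp_le)
      \<comment> \<open>The right-hand side is the value of \<open>c \<bullet> y - e\<close> at
        \<open>y = z + \<epsilon> *\<^sub>R (x - z)\<close>, which is negative by the choice of the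
        hyperplane.\<close>
      then have "0 \<le> Re (tr ?I W) / card ?I + \<epsilon> * (Re (tr ?I (mprod ?I \<rho> W)) - Re (tr ?I W) / card ?I)"
        using I \<rho> \<epsilon> bound Re_tr_nonneg_of_block_positive
        by (intro shrunken_state_expectation_nonneg[where R = R]) (auto simp: card_idx)
      moreover have "Re (tr ?I (mprod ?I \<rho> W)) = c \<bullet> x - e"
        unfolding W_def x using \<rho> by (simp add: Re_tr_mprod_witness density_on_def)
      moreover have "Re (tr ?I W) / card ?I = c \<bullet> z - e"
      proof -
        have "tr ?I \<tau> = 1" unfolding tr_def \<tau>_def using D by (simp add: card_idx)
        then have "c \<bullet> z - e = Re (tr ?I (mprod ?I \<tau> W))"
          unfolding W_def z_def by (simp add: Re_tr_mprod_witness)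
        also have "\<dots> = Re (tr ?I W) / card ?I"
          unfolding \<tau>_def tr_mprod_scalar[OF finite_idx] card_idx by simp
        finally show ?thesis by simp
      qed
      ultimately show False using c(1) by (simp add: inner_add_right inner_diff_right algebra_simps)
    qed
  qed (simp_all add: convex_jnr convex_jnr_sep bounded_jnr bounded_subset[OF bounded_jnr jnr_sep_subset_jnr]
        interior_jnr_nonempty[OF I adm] \<epsilon>)
  then show "ereal (\<epsilon> ^ CARD('k)) \<le> ereal (measure lebesgue (jnr_sep n d A) / measure lebesgue (jnr n d A))"
    by simp
qed

section \<open>Comparison of the constants\<close>

text \<open>The bound is 1/b^2, rewritten as (2 - 1/D)^(n-2) (1 - 1/D^2) + 1/D^n. For two parties
  both sides are 1. Otherwise each local dimension is at most D/4, and one of the factors has enough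
  room to absorb 1 - 1/D^2.\<close>

lemma prod_two_minus_inverse_le:
  fixes D :: real
  assumes d: "\<And>i. i < n \<Longrightarrow> 2 \<le> d i" and n: "2 \<le> n" and D: "D = real (totdim n d)"
  shows "(\<Prod>i\<in>{2..<n}. 2 - 1 / real (d i)) \<le> ((2 * D - 1) ^ (n - 2) * (D\<^sup>2 - 1) + 1) / D ^ n"
    and "1 \<le> (\<Prod>i\<in>{2..<n}. 2 - 1 / real (d i))"
    and "4 \<le> D"
proof -
  have half: "1 / real (d i) \<le> 1 / 2" if "i < n" for i
    using d[OF that] by (intro divide_left_mono) auto
  show "1 \<le> (\<Prod>i\<in>{2..<n}. 2 - 1 / real (d i))"
  proof (rule prod_ge_1)
    fix i assume "i \<in> {2..<n}"
    then show "1 \<le> 2 - 1 / real (d i)" using half[of i] by simp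
  qed
  have pow: "2 ^ card S \<le> (\<Prod>i\<in>S. real (d i))" if "S \<subseteq> {..<n}" for S
  proof -
    have "(\<Prod>i\<in>S. 2 :: real) \<le> (\<Prod>i\<in>S. real (d i))"
    proof (rule prod_mono)
      fix i assume "i \<in> S"
      then have "2 \<le> d i" using that d by blast
      then show "0 \<le> (2::real) \<and> 2 \<le> real (d i)" by simp
    qed
    then show ?thesis by simp
  qed
  have "(2::real) ^ 2 \<le> 2 ^ n" using n by (intro power_increasing) auto
  then show D4: "4 \<le> D" using pow[of "{..<n}"] unfolding D totdim_def by simp
  define m where "m = n - 2"
  have nm: "n = m + 2" using n by (simp add: m_def)
  have rhs: "((2 * D - 1) ^ (n - 2) * (D\<^sup>2 - 1) + 1) / D ^ n = (2 - 1 / D) ^ m * (1 - 1 / D\<^sup>2) + 1 / D ^ n"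
  proof -
    have "2 - 1 / D = (2 * D - 1) / D" "1 - 1 / D\<^sup>2 = (D\<^sup>2 - 1) / D\<^sup>2"
      using D4 by (auto simp: field_simps)
    then have "(2 - 1 / D) ^ m * (1 - 1 / D\<^sup>2) = (2 * D - 1) ^ m * (D\<^sup>2 - 1) / D ^ n"
      unfolding nm power_add by (simp add: power_divide)
    then show ?thesis unfolding m_def by (simp add: add_divide_distrib)
  qed
  show "(\<Prod>i\<in>{2..<n}. 2 - 1 / real (d i)) \<le> ((2 * D - 1) ^ (n - 2) * (D\<^sup>2 - 1) + 1) / D ^ n"
  proof (cases m)
    case 0
    then show ?thesis unfolding rhs nm using D4 by (simp add: power2_eq_square)
  next
    case (Suc m')
    have "(\<Prod>i\<in>{2..<n}. 2 - 1 / real (d i)) \<le> (\<Prod>i\<in>{2..<n}. 2 - 4 / D)"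
    proof (rule prod_mono)
      fix i assume i: "i \<in> {2..<n}"
      have "card ({..<n} - {i}) = n - 1" using i by simp
      \<comment> \<open>There are at least three parties here, so those other than \<open>i\<close>
        contribute at least 2 * 2 to \<open>D\<close>.\<close>
      then have "(2::real) ^ 2 \<le> 2 ^ card ({..<n} - {i})"
        using nm Suc by (intro power_increasing) auto
      also have "\<dots> \<le> (\<Prod>j\<in>{..<n} - {i}. real (d j))" by (rule pow) auto
      finally have "4 * real (d i) \<le> (\<Prod>j\<in>{..<n} - {i}. real (d j)) * real (d i)"
        by (intro mult_right_mono) auto
      also have "\<dots> = D" unfolding D totdim_def using i by (simp add: prod.remove[of "{..<n}" i] mult.commute)
      finally have "4 * real (d i) \<le> D" .
      moreover have "0 < real (d i)" using d[of i] i by simp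
      ultimately have "4 / D \<le> 1 / real (d i)" using D4 by (simp add: field_simps)
      then show "0 \<le> 2 - 1 / real (d i) \<and> 2 - 1 / real (d i) \<le> 2 - 4 / D" using half[of i] i by simp
    qed
    also have "\<dots> = (2 - 4 / D) ^ m' * (2 - 4 / D)" using nm Suc by simp
    also have "\<dots> \<le> (2 - 1 / D) ^ m' * ((2 - 1 / D) * (1 - 1 / D\<^sup>2))"
    proof (intro mult_mono power_mono zero_le_power)
      have D1: "4 / D \<le> 1" "0 < 1 / D" "1 / D \<le> 1" using D4 by auto
      show "2 - 4 / D \<le> 2 - 1 / D" "0 \<le> 2 - 4 / D" "0 \<le> 2 - 4 / D" using D1 D4
        by (auto simp: field_simps)
      \<comment> \<open>In terms of x = 1/D the claim is 3 x - 2 x^2 + x^3 \<ge> 0, which holds on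
        [0, 1] because x^2 \<le> x.\<close>
      define x where "x = 1 / D"
      have x: "0 \<le> x" "x \<le> 1" using D1 by (auto simp: x_def)
      then have "x * x \<le> x * 1" "0 \<le> x * (x * x)" by (intro mult_left_mono, auto)
      moreover have "(2 - x) * (1 - x * x) - (2 - 4 * x) = 3 * x - 2 * (x * x) + x * (x * x)"
        by (simp add: algebra_simps)
      ultimately have "2 - 4 * x \<le> (2 - x) * (1 - x * x)" using x by linarith
      then show "2 - 4 / D \<le> (2 - 1 / D) * (1 - 1 / D\<^sup>2)" by (simp add: x_def power2_eq_square)
    qed (use D4 in \<open>auto simp: field_simps\<close>)
    also have "\<dots> \<le> (2 - 1 / D) ^ m * (1 - 1 / D\<^sup>2) + 1 / D ^ n"
      using D4 Suc by simp
    finally show ?thesis unfolding rhs .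
  qed
qed

theorem theorem5:
  fixes n :: nat and d :: "nat \<Rightarrow> nat" and dd :: nat
  assumes "n \<ge> 2" and "\<forall>i<n. d i \<ge> 2" and "dd \<ge> 2"
  shows "(let D = real (totdim n d);
              b = sqrt (D ^ n / ((2 * D - 1) ^ (n - 2) * (D\<^sup>2 - 1) + 1))
          in mu n d TYPE('k::finite) \<ge> ereal ((b / D * sqrt ((D - 1) / (D - b\<^sup>2))) ^ CARD('k)))
       \<and> mu 2 (\<lambda>_. dd) TYPE('k) \<ge> ereal (1 / (real dd ^ 2 - 1) ^ CARD('k))"
proof
  define D where "D = real (totdim n d)"
  \<comment> \<open>The reciprocal of \<open>b\<^sup>2\<close>, which dominates the product
    \<open>P\<close> of the factors contributed by the parties from the third on.\<close>
  define R where "R = ((2 * D - 1) ^ (n - 2) * (D\<^sup>2 - 1) + 1) / D ^ n"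
  define b where "b = sqrt (D ^ n / ((2 * D - 1) ^ (n - 2) * (D\<^sup>2 - 1) + 1))"
  define P where "P = (\<Prod>i\<in>{2..<n}. 2 - 1 / real (d i))"
  have PR: "P \<le> R" "1 \<le> P" and D: "4 \<le> D"
    unfolding P_def R_def using prod_two_minus_inverse_le[OF _ assms(1) D_def] assms(2) by blast+
  have R1: "1 \<le> R" using PR by simp
  have tot: "0 < totdim n d" unfolding totdim_def using assms(2) by (intro prod_pos) force
  have b: "b\<^sup>2 = 1 / R"
  proof -
    have "0 \<le> D ^ n / ((2 * D - 1) ^ (n - 2) * (D\<^sup>2 - 1) + 1)" using D by simp
    then show ?thesis unfolding b_def R_def by simp
  qed
  have b0: "0 \<le> b" unfolding b_def using D by simp
  define \<epsilon> where "\<epsilon> = b / D * sqrt ((D - 1) / (D - b\<^sup>2))"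
  have RD: "0 < R * D - 1"
    using mult_mono[of 1 R 4 D] R1 D by simp
  have Db: "D - b\<^sup>2 = (R * D - 1) / R" unfolding b using R1 by (simp add: field_simps)
  have Db0: "0 < D - b\<^sup>2" unfolding Db using RD R1 by simp
  have "\<epsilon>\<^sup>2 = b\<^sup>2 / D\<^sup>2 * ((D - 1) / (D - b\<^sup>2))"
    unfolding \<epsilon>_def power_mult_distrib power_divide using Db0 D by simp
  also have "\<dots> = (D - 1) / (D\<^sup>2 * (R * D - 1))"
    unfolding Db unfolding b using R1 by simp
  finally have "\<epsilon>\<^sup>2 = (D - 1) / (D\<^sup>2 * (R * D - 1))" .
  \<comment> \<open>The requirement on \<epsilon> holds with room to spare, namely the factor ((D -
    1) / D)^2.\<close>
  then have "\<epsilon>\<^sup>2 * ((R * D - 1) * (D - 1)) = ((D - 1) / D)\<^sup>2"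
    using RD by (simp add: power2_eq_square)
  also have "\<dots> \<le> 1" using D by (simp add: power_le_one)
  finally have \<epsilon>2: "\<epsilon>\<^sup>2 * ((R * D - 1) * (D - 1)) \<le> 1" .
  have \<epsilon>0: "0 \<le> \<epsilon>" unfolding \<epsilon>_def using b0 D Db0 by simp
  have bound: "frob2 (idx n d) W \<le> R * (Re (tr (idx n d) W))\<^sup>2" if W: "block_positive n d W" for W
  proof -
    have n2: "n - 2 + 2 = n" using assms(1) by simp
    have "\<forall>i<n. 0 < d i" using assms(2) by force
    then have "frob2 (idx n d) W \<le> P * (Re (tr (idx n d) W))\<^sup>2"
      using frob2_le_of_block_positive[of "n - 2" d W] W unfolding n2 P_def by blast
    also have "\<dots> \<le> R * (Re (tr (idx n d) W))\<^sup>2" using PR by (intro mult_right_mono) auto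
    finally show ?thesis .
  qed
  have "ereal (\<epsilon> ^ CARD('k)) \<le> mu n d TYPE('k)"
    using \<epsilon>2 unfolding D_def by (intro mu_ge_of_frob2_bound[OF tot bound \<epsilon>0])
  then show "let D = real (totdim n d);
              b = sqrt (D ^ n / ((2 * D - 1) ^ (n - 2) * (D\<^sup>2 - 1) + 1))
          in mu n d TYPE('k::finite) \<ge> ereal ((b / D * sqrt ((D - 1) / (D - b\<^sup>2))) ^ CARD('k))"
    unfolding Let_def \<epsilon>_def b_def D_def .
next
  have tot: "totdim 2 (\<lambda>_. dd) = dd\<^sup>2" by (simp add: totdim_def)
  have "(2::real)\<^sup>2 \<le> (real dd)\<^sup>2" using assms(3) by (intro power_mono) auto
  then have dd: "4 \<le> (real dd)\<^sup>2" by simp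
  have "ereal ((1 / ((real dd)\<^sup>2 - 1)) ^ CARD('k)) \<le> mu 2 (\<lambda>_. dd) TYPE('k)"
  \<comment> \<open>For two parties \<open>R\<close> is 1, and with D the square of
    \<open>dd\<close> the ratio 1 / (D - 1) is the largest one that the requirement (\<epsilon> (D -
    1))^2 \<le> 1 allows.\<close>
  proof (rule mu_ge_of_frob2_bound[where R = 1])
    show "frob2 (idx 2 (\<lambda>_. dd)) W \<le> 1 * (Re (tr (idx 2 (\<lambda>_. dd)) W))\<^sup>2"
      if "block_positive 2 (\<lambda>_. dd) W" for W
      using block_positive_2 that by (simp add: numeral_2_eq_2)
    show "(1 / ((real dd)\<^sup>2 - 1))\<^sup>2 * ((1 * real (totdim 2 (\<lambda>_. dd)) - 1) * (real (totdim 2 (\<lambda>_. dd)) - 1)) \<le> 1"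
      unfolding tot using dd by (simp add: power2_eq_square)
  qed (use assms(3) dd tot in auto)
  then show "ereal (1 / (real dd ^ 2 - 1) ^ CARD('k)) \<le> mu 2 (\<lambda>_. dd) TYPE('k)"
    by (simp add: power_one_over)
qed

end
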